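(* For all distinct $k,k'\in\mathbb T_K$, it holds that $\Phi(\sigma^k,\sigma^{k'})=\mathbb H_0+4$.
   Context: Let $K>L$ be positive integers, $\mathbb T_n=\mathbb Z/n\mathbb Z$, $V=\mathbb T_K\times\mathbb T_L$ the two-dimensional periodic square lattice, and $E$ the set of unordered nearest-neighbor bonds in $V$. Let $\mathscr N_0$ be an integer with $\frac L4<\mathscr N_0<\frac K2$, and $\mathscr N=L\mathscr N_0$. The configuration space is $\Omega=\{\eta\in\{0,1\}^V:\sum_{x\in V}\eta(x)=\mathscr N\}$, and the Hamiltonian is $\mathbb H(\eta)=-\sum_{\{x,y\}\in E}\eta(x)\eta(y)$. For $x,y\in V$, $\eta^{x\leftrightarrow y}$ is obtained from $\eta$ by exchanging the values at $x$ and $y$. Write $\eta\sim\xi$ if $\xi=\eta^{x\leftrightarrow y}\ne\eta$ for some $\{x,y\}\in E$. A path from $\eta$ to $\xi$ is a sequence $\eta=\omega_0\sim\omega_1\sim\cdots\sim\omega_N=\xi$; its height is $\max_n\mathbb H(\omega_n)$; the communication height (energy barrier) $\Phi(\eta,\xi)$ is the minimal height of a path from $\eta$ to $\xi$. For $k\in\mathbb T_K$, $\mathfrak c^k:=\{k\}\times\mathbb T_L$, and $\sigma^k\in\Omega$ is the configuration whose set of occupied sites (sites with value $1$) is $\mathfrak c^k\cup\mathfrak c^{k+1}\cup\cdots\cup\mathfrak c^{k+\mathscr N_0-1}$; these are the ground states (minimizers of $\mathbb H$). $\mathbb H_0:=-2L\mathscr N_0+L$ is their energy.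
   Formalization: The formal theorem additionally assumes L ≥ 3 and N_0 ≥ 3: for L ≤ 2 the value H_0 is not the energy of σ^k, for L = 3, N_0 = 1 one has H_0 + 4 > 0, and for N_0 = 2 (3 ≤ L ≤ 7) the barrier is at most H_0 + 3, so the claim fails there. *)

theory Defs
  imports Complex_Main "HOL-Library.FuncSet"
begin

text \<open>
  The cyclic group of integers modulo \<open>n\<close> is represented by \<open>{..<n}\<close> with addition modulo \<open>n\<close>.
\<close>

type_synonym site = "nat \<times> nat"
type_synonym config = "site \<Rightarrow> nat"

definition sites :: "nat \<Rightarrow> nat \<Rightarrow> site set" where
  "sites K L = {..<K} \<times> {..<L}"

text \<open>
  A bond is an unordered pair of distinct sites. It suffices to list the pairs in which the
  second site is the successor of the first one in one of the two coordinate directions. This is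
  a set, so for \<open>K = 2\<close> or \<open>L = 2\<close> there are no double bonds.
\<close>

definition bonds :: "nat \<Rightarrow> nat \<Rightarrow> site set set" where
  "bonds K L = {{x, y} | x y. x \<in> sites K L \<and> x \<noteq> y \<and>
     (y = ((fst x + 1) mod K, snd x) \<or> y = (fst x, (snd x + 1) mod L))}"

text \<open>
  Configurations are extensional functions, hence two of them are equal as soon as they agree
  on the lattice. \<open>N\<close> is the total number of particles.
\<close>

definition configs :: "nat \<Rightarrow> nat \<Rightarrow> nat \<Rightarrow> config set" where
  "configs K L N = {\<eta> \<in> sites K L \<rightarrow>\<^sub>E {0, 1}. (\<Sum>x\<in>sites K L. \<eta> x) = N}"

text \<open>For a bond \<open>e = {x, y}\<close> the inner product is \<open>\<eta> x * \<eta> y\<close>.\<close>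

definition hamiltonian :: "nat \<Rightarrow> nat \<Rightarrow> config \<Rightarrow> int" where
  "hamiltonian K L \<eta> = - (\<Sum>e\<in>bonds K L. \<Prod>x\<in>e. int (\<eta> x))"

definition exchange :: "config \<Rightarrow> site \<Rightarrow> site \<Rightarrow> config" where
  "exchange \<eta> x y = \<eta>(x := \<eta> y, y := \<eta> x)"

definition kawasaki_step :: "nat \<Rightarrow> nat \<Rightarrow> config \<Rightarrow> config \<Rightarrow> bool" where
  "kawasaki_step K L \<eta> \<xi> \<longleftrightarrow>
     (\<exists>x y. {x, y} \<in> bonds K L \<and> \<xi> = exchange \<eta> x y \<and> \<xi> \<noteq> \<eta>)"

text \<open>A path is the list of the configurations it visits, both end points included.\<close>

definition is_path :: "nat \<Rightarrow> nat \<Rightarrow> nat \<Rightarrow> config \<Rightarrow> config \<Rightarrow> config list \<Rightarrow> bool" where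
  "is_path K L N \<eta> \<xi> \<omega> \<longleftrightarrow>
     \<omega> \<noteq> [] \<and> hd \<omega> = \<eta> \<and> last \<omega> = \<xi> \<and> set \<omega> \<subseteq> configs K L N \<and>
     (\<forall>i. Suc i < length \<omega> \<longrightarrow> kawasaki_step K L (\<omega> ! i) (\<omega> ! Suc i))"

definition path_height :: "nat \<Rightarrow> nat \<Rightarrow> config list \<Rightarrow> int" where
  "path_height K L \<omega> = Max (hamiltonian K L ` set \<omega>)"

definition comm_height :: "nat \<Rightarrow> nat \<Rightarrow> nat \<Rightarrow> config \<Rightarrow> config \<Rightarrow> int" where
  "comm_height K L N \<eta> \<xi> = (LEAST h. \<exists>\<omega>. is_path K L N \<eta> \<xi> \<omega> \<and> path_height K L \<omega> = h)"

definition column :: "nat \<Rightarrow> nat \<Rightarrow> site set" where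
  "column L k = {k} \<times> {..<L}"

definition stripe :: "nat \<Rightarrow> nat \<Rightarrow> nat \<Rightarrow> nat \<Rightarrow> config" where
  "stripe K L N0 k =
     (\<lambda>x\<in>sites K L. if x \<in> (\<Union>m<N0. column L ((k + m) mod K)) then 1 else 0)"

definition ground_energy :: "nat \<Rightarrow> nat \<Rightarrow> int" where
  "ground_energy L N0 = - 2 * int L * int N0 + int L"

end

theory Submission
  imports Defs
begin

text \<open>
  Let \<open>E A\<close> be the number of bonds inside the occupied set \<open>A\<close>, so that the energy is \<open>- E A\<close>.
  Adding a site to \<open>A\<close> changes \<open>E\<close> by the number of its occupied neighbours.

  Lower bound: as long as \<open>E\<close> stays above \<open>E S - 4\<close>, a path from the stripe \<open>S\<close> cannot displace three
  particles. A second particle can only leave \<open>S\<close> by moving from a boundary site \<open>x\<close> straight outwards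
  to \<open>r x\<close>, and comparing degrees forces the two holes to be vertically adjacent, the two displaced
  particles to be vertically adjacent, and both pairs to overlap in exactly one row. From such a
  ``kink'' every affordable move leads back to one displaced particle or to another kink.

  Upper bound: transport one column to the other side of the stripe row by row, by pushing out the
  particle at the far end of the row and then moving the resulting hole through the stripe.
\<close>

section \<open>The trap around a stripe\<close>

text \<open>Holes at \<open>x\<close> and \<open>u x\<close>, displaced particles at
  \<open>r x\<close> and \<open>r (d x)\<close>: two vertical pairs that share only the row of
  \<open>x\<close>. Exchanging \<open>r\<close> with \<open>l\<close> and \<open>u\<close> with
  \<open>d\<close> gives the four orientations.\<close>

definition kink :: "('a \<Rightarrow> 'a) \<Rightarrow> ('a \<Rightarrow> 'a) \<Rightarrow> ('a \<Rightarrow> 'a) \<Rightarrow> 'a set \<Rightarrow> 'a set \<Rightarrow> bool" where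
  "kink r u d S A \<longleftrightarrow> (\<exists>x\<in>S. r x \<notin> S \<and> A = insert (r x) (insert (r (d x)) (S - {x, u x})))"

text \<open>
  The axioms are invariant under exchanging \<open>r\<close> with \<open>l\<close> and \<open>u\<close> with \<open>d\<close>, so only one orientation of
  a kink has to be analysed. For this reason \<open>E\<close> is a parameter with its insertion rule as an axiom:
  both reflected instances then speak about the same \<open>E\<close>.
\<close>

locale wide_stripe =
  fixes V :: "'a set" and r l u d :: "'a \<Rightarrow> 'a" and S :: "'a set" and E :: "'a set \<Rightarrow> int"
  assumes closed [simp]: "x \<in> V \<Longrightarrow> r x \<in> V" "x \<in> V \<Longrightarrow> l x \<in> V"
      "x \<in> V \<Longrightarrow> u x \<in> V" "x \<in> V \<Longrightarrow> d x \<in> V"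
    and inv [simp]: "x \<in> V \<Longrightarrow> r (l x) = x" "x \<in> V \<Longrightarrow> l (r x) = x"
      "x \<in> V \<Longrightarrow> u (d x) = x" "x \<in> V \<Longrightarrow> d (u x) = x"
    and comm: "x \<in> V \<Longrightarrow> r (u x) = u (r x)" "x \<in> V \<Longrightarrow> r (d x) = d (r x)"
      "x \<in> V \<Longrightarrow> l (u x) = u (l x)" "x \<in> V \<Longrightarrow> l (d x) = d (l x)"
    and neq: "x \<in> V \<Longrightarrow> r x \<noteq> x" "x \<in> V \<Longrightarrow> u x \<noteq> x" "x \<in> V \<Longrightarrow> u (u x) \<noteq> x"
    and S_sub: "S \<subseteq> V"
    and S_vert: "x \<in> V \<Longrightarrow> u x \<in> S \<longleftrightarrow> x \<in> S" "x \<in> V \<Longrightarrow> d x \<in> S \<longleftrightarrow> x \<in> S"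
    and right_end: "x \<in> S \<Longrightarrow> r x \<notin> S \<Longrightarrow>
      l x \<in> S \<and> l (l x) \<in> S \<and> r (r x) \<notin> S \<and> r (r (r x)) \<notin> S"
    and left_end: "x \<in> S \<Longrightarrow> l x \<notin> S \<Longrightarrow>
      r x \<in> S \<and> r (r x) \<in> S \<and> l (l x) \<notin> S \<and> l (l (l x)) \<notin> S"
    and E_insert: "B \<subseteq> V \<Longrightarrow> v \<in> V \<Longrightarrow> v \<notin> B \<Longrightarrow>
      E (insert v B) = E B + (of_bool (r v \<in> B) + of_bool (l v \<in> B) + of_bool (u v \<in> B) + of_bool (d v \<in> B))"
begin

lemma flip_horizontal: "wide_stripe V l r u d S E"
proof unfold_locales
  fix x assume "x \<in> V"
  then show "l x \<noteq> x"
    using neq(1)[of "l x"] by auto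
next
  fix B v assume "B \<subseteq> V" "v \<in> V" "v \<notin> B"
  then show "E (insert v B) = E B + (of_bool (l v \<in> B) + of_bool (r v \<in> B) + of_bool (u v \<in> B) + of_bool (d v \<in> B))"
    using E_insert[of B v] by linarith
qed (fact closed inv comm neq S_sub S_vert right_end left_end)+

lemma flip_vertical: "wide_stripe V r l d u S E"
proof unfold_locales
  fix x assume "x \<in> V"
  then show "d x \<noteq> x" "d (d x) \<noteq> x"
    using neq(2)[of "d x"] neq(3)[of "d (d x)"] by auto
next
  fix B v assume "B \<subseteq> V" "v \<in> V" "v \<notin> B"
  then show "E (insert v B) = E B + (of_bool (r v \<in> B) + of_bool (l v \<in> B) + of_bool (d v \<in> B) + of_bool (u v \<in> B))"
    using E_insert[of B v] by linarith
qed (fact closed inv comm neq S_sub S_vert right_end left_end)+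

section \<open>Particle sets confined below the barrier\<close>

definition near :: "'a set \<Rightarrow> bool" where
  "near A \<longleftrightarrow> A = S \<or> (\<exists>x\<in>S. \<exists>y\<in>V - S. A = insert y (S - {x}))"

text \<open>The invariant of all paths below the barrier. A single displaced particle may be
  anywhere outside \<open>S\<close>, whereas two are allowed only as a kink, in any of its four
  orientations.\<close>

definition trapped :: "'a set \<Rightarrow> bool" where
  "trapped A \<longleftrightarrow> near A \<or> kink r u d S A \<or> kink r d u S A \<or> kink l u d S A \<or> kink l d u S A"

text \<open>Remove \<open>p\<close>, then insert \<open>q\<close>: both degrees are counted in
  \<open>A - {p}\<close>, so the moving particle never counts as its own neighbour.\<close>

lemma E_swap:
  assumes "A \<subseteq> V" "p \<in> A" "q \<in> V - A"
  shows "E (insert q (A - {p})) = E A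
    - (of_bool (r p \<in> A - {p}) + of_bool (l p \<in> A - {p}) + of_bool (u p \<in> A - {p}) + of_bool (d p \<in> A - {p}))
    + (of_bool (r q \<in> A - {p}) + of_bool (l q \<in> A - {p}) + of_bool (u q \<in> A - {p}) + of_bool (d q \<in> A - {p}))"
proof -
  have "A - {p} \<subseteq> V" "p \<in> V" "q \<in> V" "q \<notin> A - {p}" "p \<notin> A - {p}"
    using assms by auto
  then show ?thesis
    using E_insert[of "A - {p}" p, unfolded insert_Diff[OF assms(2)]] E_insert[of "A - {p}" q] by linarith
qed

lemma shift_inj [simp]:
  assumes "x \<in> V" "y \<in> V"
  shows "r x = r y \<longleftrightarrow> x = y" "l x = l y \<longleftrightarrow> x = y" "u x = u y \<longleftrightarrow> x = y" "d x = d y \<longleftrightarrow> x = y"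
  using inv assms by metis+

lemma neq_shift [simp]:
  assumes "x \<in> V"
  shows "r x \<noteq> x" "l x \<noteq> x" "u x \<noteq> x" "d x \<noteq> x" "u (u x) \<noteq> x" "d (d x) \<noteq> x" "u x \<noteq> d x" "d x \<noteq> u x" "x \<noteq> u x" "x \<noteq> d x"
proof -
  show "r x \<noteq> x" "l x \<noteq> x" "u x \<noteq> x" "d x \<noteq> x" "u (u x) \<noteq> x" "d (d x) \<noteq> x"
    using neq(1)[of x] neq(2)[of x] neq(3)[of x] neq(1)[of "l x"] neq(2)[of "d x"] neq(3)[of "d (d x)"] assms
    by auto
  then show "x \<noteq> u x" "x \<noteq> d x" by metis+
  show "u x \<noteq> d x" "d x \<noteq> u x"
    using neq(3)[of "d x"] assms by auto
qed

text \<open>The two displacements together cost at least four bonds unless the holes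
  \<open>x\<close> and \<open>x'\<close> are vertically adjacent. Then they cost at least three, and
  equality in every estimate leaves only a kink.\<close>

lemma second_defect:
  assumes x: "x \<in> S" "x' \<in> S" "x \<noteq> x'" and y: "y \<in> V - S" "r x' \<notin> S" "y \<noteq> r x'"
    and e: "E (insert (r x') (insert y (S - {x}) - {x'})) \<ge> E S - 3"
  shows "kink r u d S (insert (r x') (insert y (S - {x}) - {x'})) \<or>
         kink r d u S (insert (r x') (insert y (S - {x}) - {x'}))"
proof -
  have V: "x \<in> V" "x' \<in> V" "y \<in> V" using x y S_sub by auto
  have e1: "E (insert y (S - {x})) = E S 
     - (of_bool (r x \<in> S - {x}) + of_bool (l x \<in> S - {x}) + of_bool (u x \<in> S - {x}) + of_bool (d x \<in> S - {x}))
     + (of_bool (r y \<in> S - {x}) + of_bool (l y \<in> S - {x}) + of_bool (u y \<in> S - {x}) + of_bool (d y \<in> S - {x}))"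
    by (rule E_swap) (use S_sub x y in auto)
  let ?A = "insert y (S - {x})"
  have e2: "E (insert (r x') (?A - {x'})) = E ?A
    - (of_bool (r x' \<in> ?A - {x'}) + of_bool (l x' \<in> ?A - {x'}) + of_bool (u x' \<in> ?A - {x'}) + of_bool (d x' \<in> ?A - {x'}))
    + (of_bool (r (r x') \<in> ?A - {x'}) + of_bool (l (r x') \<in> ?A - {x'}) + of_bool (u (r x') \<in> ?A - {x'}) + of_bool (d (r x') \<in> ?A - {x'}))"
    by (rule E_swap) (use S_sub x y V in auto)
  note x_neq = neq_shift[OF V(1)] and x'_neq = neq_shift[OF V(2)]
  have right: "l x' \<in> S" "l (l x') \<in> S" "r (r x') \<notin> S" "r (r (r x')) \<notin> S"
    using right_end[OF x(2) y(2)] by simp_all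
  \<comment> \<open>The stripe is wide enough that no site of it lacks both horizontal
    neighbours.\<close>
  have deg_x: "of_bool (r x \<in> S) + of_bool (l x \<in> S) \<ge> (1::int)"
    using right_end[OF x(1)] by (cases "r x \<in> S") simp_all
  \<comment> \<open>The gap outside \<open>S\<close> is more than one site wide, so \<open>y\<close>
    cannot touch \<open>S\<close> on both sides.\<close>
  have deg_y: "of_bool (r y \<in> S - {x}) + of_bool (l y \<in> S - {x}) \<le> (1::int)"
    using right_end[of "l y"] V y by (cases "l y \<in> S") simp_all
  \<comment> \<open>The \<open>2\<close> counts the vertical neighbours of \<open>x\<close>: they
    lie in \<open>S\<close> by vertical invariance, which also keeps those of \<open>y\<close>
    outside \<open>S\<close>.\<close>
  have e1': "E ?A = E S - 2 - (of_bool (r x \<in> S) + of_bool (l x \<in> S))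
      + (of_bool (r y \<in> S - {x}) + of_bool (l y \<in> S - {x}))"
    using e1 x_neq S_vert V x y by simp
  have rr_x': "r (r x') \<noteq> x'" using right x by auto
  \<comment> \<open>Around \<open>x'\<close> the left, upper and lower sites are occupied unless
    they are the hole \<open>x\<close>. Around the target \<open>r x'\<close> the only particle that
    can be present is \<open>y\<close>.\<close>
  have e2': "E (insert (r x') (?A - {x'})) = E ?A - (of_bool (l x' \<noteq> x) + of_bool (u x' \<noteq> x) + of_bool (d x' \<noteq> x))
      + (of_bool (r (r x') = y) + of_bool (u (r x') = y) + of_bool (d (r x') = y))"
  proof -
    have "(r x' \<in> ?A - {x'}) = False" "(l x' \<in> ?A - {x'}) = (l x' \<noteq> x)"
      "(u x' \<in> ?A - {x'}) = (u x' \<noteq> x)" "(d x' \<in> ?A - {x'}) = (d x' \<noteq> x)"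
      "(r (r x') \<in> ?A - {x'}) = (r (r x') = y)" "(l (r x') \<in> ?A - {x'}) = False"
      "(u (r x') \<in> ?A - {x'}) = (u (r x') = y)" "(d (r x') \<in> ?A - {x'}) = (d (r x') = y)"
      using x'_neq right rr_x' S_vert V x y by auto
    from e2[unfolded this of_bool_eq] show ?thesis by linarith
  qed
  have rr: "r (r x') = y \<Longrightarrow> r y \<notin> S \<and> l y \<notin> S" using right y V by auto
  have ur: "u (r x') = y \<Longrightarrow> r y \<notin> S \<and> l y = u x'"
    using right S_vert V comm closed inv by metis
  have dr: "d (r x') = y \<Longrightarrow> r y \<notin> S \<and> l y = d x'"
    using right S_vert V comm closed inv by metis
  note ud = neq_shift(7)[OF V(2)]
  have "l y \<in> S" if "u (r x') = y \<or> d (r x') = y"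
    using ur dr S_vert V x that by metis
  \<comment> \<open>The three positions exclude each other: the two vertical ones differ and have
    their left neighbour in \<open>S\<close>, while \<open>r (r x')\<close> has no horizontal
    neighbour in \<open>S\<close>.\<close>
  then have deg_y': "of_bool (r (r x') = y) + of_bool (u (r x') = y) + of_bool (d (r x') = y) \<le> (1::int)"
    using rr ur dr ud by (cases "r (r x') = y"; cases "u (r x') = y"; cases "d (r x') = y") auto
  have e3: "2 + (of_bool (r x \<in> S) + of_bool (l x \<in> S)) + (of_bool (l x' \<noteq> x) + of_bool (u x' \<noteq> x) + of_bool (d x' \<noteq> x))
     - (of_bool (r y \<in> S - {x}) + of_bool (l y \<in> S - {x}))
     - (of_bool (r (r x') = y) + of_bool (u (r x') = y) + of_bool (d (r x') = y)) \<le> (3::int)"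
    using e unfolding e1' e2' by linarith
  have lu: "l x' \<noteq> u x'" "l x' \<noteq> d x'" 
    using right S_vert V x y comm closed inv by metis+
  \<comment> \<open>Otherwise both vertical bonds of \<open>x'\<close> are lost. Either the bond to
    \<open>l x'\<close> is lost too, or \<open>l x' = x\<close> and then \<open>x\<close> had both
    horizontal neighbours; in both cases the total is at least four.\<close>
  have up: "x = u x' \<or> x = d x'"
  proof (rule ccontr)
    assume no: "\<not> ?thesis"
    then have n2: "of_bool (u x' \<noteq> x) = (1::int)" "of_bool (d x' \<noteq> x) = (1::int)" by auto
    show False
    proof (cases "l x' = x")
      case True
      then have "r x \<in> S" "l x \<in> S" using right V x by auto
      then have "of_bool (r x \<in> S) = (1::int)" "of_bool (l x \<in> S) = (1::int)" by auto
      moreover have "of_bool (l x' \<noteq> x) \<ge> (0::int)" by simp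
      ultimately show ?thesis using e3 n2 deg_y deg_y' by linarith
    next
      case False
      then have "of_bool (l x' \<noteq> x) = (1::int)" by simp
      then show ?thesis using e3 deg_x deg_y deg_y' n2 by linarith
    qed
  qed
  then have "of_bool (l x' \<noteq> x) + of_bool (u x' \<noteq> x) + of_bool (d x' \<noteq> x) = (2::int)"
    using lu ud by auto
  \<comment> \<open>Now the total is at least \<open>2 + 1 + 2 - 1 - 1 = 3\<close>, so both upper
    bounds for \<open>y\<close> must be attained.\<close>
  then have "of_bool (r y \<in> S - {x}) + of_bool (l y \<in> S - {x}) = (1::int)"
    "of_bool (r (r x') = y) + of_bool (u (r x') = y) + of_bool (d (r x') = y) = (1::int)"
    using e3 deg_x deg_y deg_y' by linarith+
  then have a: "r y \<in> S - {x} \<or> l y \<in> S - {x}" "r (r x') = y \<or> u (r x') = y \<or> d (r x') = y" 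
    by (auto simp: of_bool_def split: if_splits)
  from up show ?thesis
  proof
    assume xu: "x = u x'"
    \<comment> \<open>The position \<open>u (r x')\<close> is excluded because its left neighbour is
      the hole \<open>x\<close>, and \<open>r (r x')\<close> because it does not touch
      \<open>S\<close>.\<close>
    then have "y = r (d x')" using a rr ur dr comm V by auto
    then have "kink r u d S (insert (r x') (insert y (S - {x}) - {x'}))"
      unfolding kink_def by (intro bexI[of _ x']) (use xu x y in auto)
    then show ?thesis ..
  next
    assume xd: "x = d x'"
    then have "y = r (u x')" using a rr ur dr comm V by auto
    then have "kink r d u S (insert (r x') (insert y (S - {x}) - {x'}))"
      unfolding kink_def by (intro bexI[of _ x']) (use xd x y in auto)
    then show ?thesis ..
  qed
qed


text \<open>Compare with the core \<open>S - {x, u x}\<close>: the two removals cost three and two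
  bonds, and the displaced particles regain one each. A kink therefore sits exactly at the lowest
  value of \<open>E\<close> still allowed.\<close>

lemma E_kink:
  assumes "kink r u d S A"
  shows "E A = E S - 3" "A \<subseteq> V"
proof -
  obtain x where x: "x \<in> S" "r x \<notin> S" and A: "A = insert (r x) (insert (r (d x)) (S - {x, u x}))"
    using assms unfolding kink_def by blast
  have V: "x \<in> V" using x S_sub by auto
  note neqs = neq_shift[OF V]
  define B where "B = S - {x, u x}"
  have ux: "u x \<in> S" "r (u x) \<notin> S" "d x \<in> S" "r (d x) \<notin> S"
    using x V S_vert comm by simp_all
  have right: "l x \<in> S" "r (r x) \<notin> S" "l (u x) \<in> S" "r (r (d x)) \<notin> S"
    using right_end[OF x] right_end[OF ux(1,2)] right_end[OF ux(3,4)] by auto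
  have B: "B \<subseteq> V" "x \<notin> B" "u x \<notin> B" "insert x (insert (u x) B) = S"
    using S_sub x ux unfolding B_def by auto
  have "r (l x) = x" "r (l (u x)) = u x" using V by simp_all
  then have lneq: "l x \<noteq> u x" "l (u x) \<noteq> u x" "l (u x) \<noteq> x" "l x \<noteq> x" 
    using x ux V neqs by metis+
  have "E (insert (u x) B) = E B + 2"
  proof -
    have "r (u x) \<notin> B" "l (u x) \<in> B" "u (u x) \<in> B" "d (u x) \<notin> B"
      using x V ux right neqs S_vert lneq unfolding B_def by simp_all
    then show ?thesis using E_insert[of B "u x"] B V by simp
  qed
  moreover have "E S = E (insert (u x) B) + 3"
  proof -
    have "r x \<notin> insert (u x) B" "l x \<in> insert (u x) B" "d x \<in> insert (u x) B"
      using x V ux right neqs lneq unfolding B_def by auto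
    then show ?thesis using E_insert[of "insert (u x) B" x] B V neqs by simp
  qed
  moreover have "E (insert (r (d x)) B) = E B + 1"
  proof -
    have "r (d x) \<notin> B" "r (r (d x)) \<notin> B" "l (r (d x)) \<in> B" "u (r (d x)) \<notin> B" "d (r (d x)) \<notin> B"
      using x V ux right neqs S_vert unfolding B_def by auto
    then show ?thesis using E_insert[of B "r (d x)"] B V by simp
  qed
  moreover have "E A = E (insert (r (d x)) B) + 1"
  proof -
    let ?C = "insert (r (d x)) B"
    have "u (r x) = r (u x)" using V comm by simp
    then have "r (d x) \<noteq> r x" "u (r x) \<noteq> r (d x)" using V by simp_all
    moreover have "r (r x) \<noteq> r (d x)" using V x ux by auto
    moreover have "d (r x) \<noteq> x" "d (r x) \<noteq> r x" using S_vert(2)[of "r x"] V x by auto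
    ultimately have "r x \<notin> ?C" "r (r x) \<notin> ?C" "l (r x) \<notin> ?C" "u (r x) \<notin> ?C" "d (r x) \<in> ?C"
      using x V ux right neqs S_vert comm unfolding B_def by auto
    then show ?thesis using E_insert[of ?C "r x"] B V unfolding A B_def[symmetric] by simp
  qed
  ultimately show "E A = E S - 3" by linarith
  show "A \<subseteq> V" using A V S_sub by auto
qed

text \<open>Since \<open>E A = E S - 3\<close>, the next move must not lose a bond. In general only
  the return of \<open>r x\<close> to \<open>x\<close> survives this test; the other surviving moves
  need columns of length three and reverse the vertical orientation of the kink.\<close>

lemma kink_step:
  assumes kink: "kink r u d S A" and p: "p \<in> A" and q: "q \<in> V - A" "q \<in> {r p, l p, u p, d p}"
    and e: "E (insert q (A - {p})) \<ge> E S - 3"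
  shows "near (insert q (A - {p})) \<or> kink r u d S (insert q (A - {p})) \<or> kink r d u S (insert q (A - {p}))"
proof -
  obtain x where x: "x \<in> S" "r x \<notin> S" and A: "A = insert (r x) (insert (r (d x)) (S - {x, u x}))"
    using kink unfolding kink_def by blast
  note AV = E_kink[OF kink]
  have V: "x \<in> V" "p \<in> V" "q \<in> V" using x S_sub p q AV by auto
  have ux: "u x \<in> S" "r (u x) \<notin> S" "d x \<in> S" "r (d x) \<notin> S"
    using x V S_vert comm by simp_all
  have right: "l x \<in> S" "r (r x) \<notin> S" "l (u x) \<in> S" "r (r (d x)) \<notin> S" "l (l x) \<in> S" "r (r (r x)) \<notin> S"
     "r (r (r (d x))) \<notin> S" "l (l (u x)) \<in> S" "l (d x) \<in> S"
    using right_end[OF x] right_end[OF ux(1,2)] right_end[OF ux(3,4)] by auto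
  note neqs = neq_shift[OF V(1)]
  \<comment> \<open>The kink alters only the two columns at the right end of \<open>S\<close>: sites
    further in are occupied, sites further out are empty.\<close>
  have inner: "v \<in> A" if "v \<in> S" "r v \<in> S" for v
    using that x ux unfolding A by auto
  have outer: "v \<notin> A" if "v \<notin> S" "l v \<notin> S" for v
    using that x ux V unfolding A by auto
  have edge: "v \<in> A \<longleftrightarrow> v \<noteq> x \<and> v \<noteq> u x" if "v \<in> S" for v
    using that x ux unfolding A by auto
  have edge': "v \<in> A \<longleftrightarrow> v = r x \<or> v = r (d x)" if "v \<notin> S" for v
    using that unfolding A by auto
  define B where "B = A - {p}"
  have deg: "of_bool (r p \<in> B) + of_bool (l p \<in> B) + of_bool (u p \<in> B) + of_bool (d p \<in> B)
    \<le> (of_bool (r q \<in> B) + of_bool (l q \<in> B) + of_bool (u q \<in> B) + of_bool (d q \<in> B) :: int)"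
    using E_swap[OF AV(2) p q(1)] e AV(1) unfolding B_def by linarith
  note pn = neq_shift[OF V(2)]
  have Bp: "r p \<in> B \<longleftrightarrow> r p \<in> A" "l p \<in> B \<longleftrightarrow> l p \<in> A" "u p \<in> B \<longleftrightarrow> u p \<in> A" "d p \<in> B \<longleftrightarrow> d p \<in> A"
    "p \<notin> B" using pn unfolding B_def by auto
  have BA: "v \<notin> A \<Longrightarrow> v \<notin> B" for v unfolding B_def by auto
  \<comment> \<open>Two cases fill a hole, two move a displaced particle outside \<open>S\<close>,
    and the last one displaces a third particle.\<close>
  consider (qx) "q = x" | (qux) "q = u x" | (rx) "q \<notin> S" "p = r x" | (rdx) "q \<notin> S" "p = r (d x)"
    | (far) "q \<notin> S" "p \<in> S"
    using p q(1) unfolding A by auto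
  then show ?thesis
  proof cases
    case qx
    then have "p \<in> {l x, r x, d x, u x}" using q(2) V by auto
    then consider "p = r x" | "p = l x" | "p = d x" using p edge[of "u x"] ux \<open>u x \<in> S\<close> by auto
    then show ?thesis
    proof cases
      case 1
      have "r (d x) \<noteq> r x" using V by simp
      then have "insert q (A - {p}) = insert (r (d x)) (S - {u x})"
        unfolding 1 qx A using neqs(3,4) x ux by auto
      moreover have "r (d x) \<in> V - S" using ux V by simp
      ultimately show ?thesis unfolding near_def using ux by blast
    next
      case 2
      \<comment> \<open>\<open>l x\<close> has three occupied neighbours. At \<open>x\<close> at
        most two remain, since \<open>u x\<close> is a hole and \<open>l x\<close> has just been
        vacated.\<close>
      have "u (l x) \<in> A" "d (l x) \<in> A" "l (l x) \<in> A"
        using inner comm V right S_vert ux \<open>x \<in> S\<close> by simp_all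
      then have "3 \<le> (of_bool (r q \<in> B) + of_bool (l q \<in> B) + of_bool (u q \<in> B) + of_bool (d q \<in> B) :: int)"
        using deg unfolding Bp 2[symmetric] by (auto simp: of_bool_def split: if_splits)
      moreover have "u q \<notin> B" "l q \<notin> B" using edge[of "u x"] ux Bp 2 unfolding qx B_def by auto
      ultimately show ?thesis by (auto simp: of_bool_def split: if_splits)
    next
      case 3
      have in_A: "r p \<in> A" "l p \<in> A" using 3 A inner[of "l p"] V right ux by auto
      have "u q \<notin> B" "d q \<notin> B" using edge[of "u x"] ux Bp 3 unfolding qx B_def by auto
      then have "d p \<notin> A" using deg in_A unfolding Bp by (auto simp: of_bool_def split: if_splits)
      \<comment> \<open>Only possible for columns of length three, where the kink flips upside down.\<close>
      then have "d (d x) = u x" using edge[of "d p"] neqs ux V S_vert 3 by simp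
      then have "insert q (A - {p}) = insert (r (d x)) (insert (r (u (d x))) (S - {d x, d (d x)}))"
        unfolding 3 qx A inv(3)[OF V(1)] \<open>d (d x) = u x\<close> using neqs(3,4) x ux by auto
      then have "kink r d u S (insert q (A - {p}))"
        unfolding kink_def using ux by blast
      then show ?thesis by blast
    qed
  next
    case qux
    then have "p \<in> {l (u x), r (u x), u (u x), x}" using q(2) V by auto
    moreover have "r (u x) \<notin> A" using edge'[of "r (u x)"] ux neqs V comm closed inv \<open>r (u x) \<notin> S\<close> by metis
    ultimately consider "p = l (u x)" | "p = u (u x)" using p edge[of x] x by auto
    then show ?thesis
    proof cases
      case 1
      \<comment> \<open>At least two neighbours are given up, but around \<open>u x\<close> only the
        upper site can be occupied.\<close>
      have "l p \<in> A" "u p \<in> A"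
        using inner comm V right S_vert \<open>u x \<in> S\<close> by (simp_all add: 1)
      then have "2 \<le> (of_bool (r q \<in> B) + of_bool (l q \<in> B) + of_bool (u q \<in> B) + of_bool (d q \<in> B) :: int)"
        using deg unfolding Bp by (auto simp: of_bool_def split: if_splits)
      moreover have "r q \<notin> B" "l q \<notin> B" "d q \<notin> B" using edge[of x] x V \<open>r (u x) \<notin> A\<close> 1 unfolding qux B_def by auto
      ultimately show ?thesis by (auto simp: of_bool_def split: if_splits)
    next
      case 2
      have "l p \<in> A" using inner[of "l p"] comm V right S_vert \<open>u x \<in> S\<close> 2 by simp
      \<comment> \<open>If the column closes up after three sites, \<open>u p\<close> is the hole
        \<open>x\<close>; then \<open>p = d x\<close> has the displaced particle
        \<open>r (d x)\<close> on its right.\<close>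
      moreover have "u p \<in> A \<or> r p \<in> A"
      proof (cases "u p = x")
        case True
        then have "d x = p" using V by auto
        then show ?thesis by (simp add: A)
      next
        case False
        then show ?thesis using edge[of "u p"] 2 V S_vert \<open>u x \<in> S\<close> neqs by (metis closed(3) inv(4))
      qed
      ultimately have "2 \<le> (of_bool (r q \<in> B) + of_bool (l q \<in> B) + of_bool (u q \<in> B) + of_bool (d q \<in> B) :: int)"
        using deg unfolding Bp by (auto simp: of_bool_def split: if_splits)
      moreover have "r q \<notin> B" "u q \<notin> B" "d q \<notin> B" using edge[of x] x V \<open>r (u x) \<notin> A\<close> 2 unfolding qux B_def by auto
      ultimately show ?thesis by (auto simp: of_bool_def split: if_splits)
    qed
  next
    case rx
    have "r (d x) = d (r x)" using comm V by auto
    then have dp: "d p \<in> A" unfolding A rx by auto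
    then have ge: "1 \<le> (of_bool (r q \<in> B) + of_bool (l q \<in> B) + of_bool (u q \<in> B) + of_bool (d q \<in> B) :: int)"
      using deg unfolding Bp by (auto simp: of_bool_def split: if_splits)
    have "q \<noteq> l p" "q \<noteq> d p" using rx dp q x V by auto
    then consider "q = r (r x)" | "q = u (r x)" using q(2) rx by auto
    then show ?thesis
    proof cases
      case 1
      have "r q \<notin> A" "u q \<notin> A" "d q \<notin> A"
        using 1 outer V right S_vert comm x by simp_all
      moreover have "l q \<notin> B" using 1 rx V unfolding B_def by simp
      ultimately show ?thesis using ge BA by (auto simp: of_bool_def split: if_splits)
    next
      case 2
      have "r q \<notin> A" using 2 outer[of "r q"] V right S_vert comm x by simp
      moreover have "l q \<notin> A" using 2 edge[of "l q"] V comm ux by simp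
      moreover have "d q \<notin> B" using 2 rx V unfolding B_def by simp
      \<comment> \<open>The left neighbour of \<open>q\<close> is the hole \<open>u x\<close> and
        the lower one has been vacated. The other displaced particle must support \<open>q\<close>
        from above, which forces columns of length three.\<close>
      ultimately have "u q \<in> A" using ge BA by (cases "u q \<in> B") (auto simp: B_def)
      then have "u q = r (d x)"
        using edge'[of "u q"] neqs V S_vert 2 x by auto
      then have "r (u (u x)) = r (d x)" using 2 comm V by simp
      then have uu: "u (u x) = d x" using V by (metis closed(3,4) inv(2))
      have "insert q (A - {p}) = insert (r (u x)) (insert (r (u (u x))) (S - {u x, d (u x)}))"
        unfolding 2 rx A uu using neqs ux x V comm by auto
      then have "kink r d u S (insert q (A - {p}))"
        unfolding kink_def using ux by blast
      then show ?thesis by blast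
    qed
  next
    case rdx
    have up: "u p = r x" using rdx V comm by (metis closed(4) inv(3))
    then have in_A: "u p \<in> A" "l p \<in> A" using edge[of "d x"] neqs ux rdx V unfolding A by auto
    have ge: "2 \<le> (of_bool (r q \<in> B) + of_bool (l q \<in> B) + of_bool (u q \<in> B) + of_bool (d q \<in> B) :: int)"
      using deg in_A unfolding Bp by (auto simp: of_bool_def split: if_splits)
    have "q \<noteq> l p" "q \<noteq> u p" using in_A q by auto
    then consider "q = r p" | "q = d p" using q(2) by auto
    then show ?thesis
    proof cases
      case 1
      have "r q \<notin> A" "d q \<notin> A"
        using 1 rdx outer V right S_vert comm ux by simp_all
      moreover have "u q \<notin> A"
        using 1 rdx outer[of "u q"] V right S_vert comm ux by simp
      moreover have "l q \<notin> B" using 1 V unfolding B_def by simp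
      ultimately show ?thesis using ge BA by (auto simp: of_bool_def split: if_splits)
    next
      case 2
      have "r q \<notin> A" using 2 rdx outer[of "r q"] V right S_vert comm ux by simp
      moreover have "u q \<notin> B" using 2 V unfolding B_def by simp
      \<comment> \<open>Two supports are needed, and they must be on the left and below. The lower
        one would be \<open>r x\<close>, met again around a column of length three, but then the
        left one is the hole \<open>u x\<close>.\<close>
      ultimately have *: "l q \<in> A" "d q \<in> A" using ge BA
        by (cases "l q \<in> B"; cases "d q \<in> B"; auto simp: B_def)+
      have "d q = r (d (d (d x)))" "l q = d (d x)" using 2 rdx V comm by simp_all
      moreover have "d q = r x \<or> d q = r (d x)" using edge'[of "d q"] * 2 rdx V ux S_vert by simp
      ultimately have "d (d (d x)) = x \<or> d (d (d x)) = d x" using V by (metis closed(4) inv(2))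
      moreover have "d (d (d x)) \<noteq> d x" using neqs V by (metis closed(4) inv(3))
      ultimately have "d (d x) = u x" using V by (metis closed(4) inv(3))
      then show ?thesis using * edge[of "u x"] ux \<open>l q = d (d x)\<close> by simp
    qed
  next
    case far
    have "q \<noteq> u p" "q \<noteq> d p" using far V S_vert by auto
    then consider "q = r p" | "q = l p" using q(2) by auto
    then show ?thesis
    proof cases
      case 1
      \<comment> \<open>\<open>p\<close> is occupied, hence not a hole; its target is empty, hence
        \<open>p\<close> is not \<open>d x\<close>.\<close>
      have pne: "p \<noteq> x" "p \<noteq> u x" "p \<noteq> d x"
        using edge[of p] p far 1 q(1) by (auto simp: A)
      have "l p \<in> A" using right_end[of p] far 1 inner[of "l p"] V by simp
      moreover have "u p \<in> A" using edge[of "u p"] pne far V S_vert by auto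
      ultimately have "2 \<le> (of_bool (r q \<in> B) + of_bool (l q \<in> B) + of_bool (u q \<in> B) + of_bool (d q \<in> B) :: int)"
        using deg unfolding Bp by (auto simp: of_bool_def split: if_splits)
      moreover have "r q \<notin> A" using outer[of "r q"] right_end[of p] far 1 V by simp
      moreover have "l q \<notin> B" using 1 V unfolding B_def by simp
      \<comment> \<open>\<open>q\<close> needs support both above and below. The lower support is a
        displaced particle, which would place \<open>p\<close> at \<open>x\<close> or
        \<open>u x\<close>.\<close>
      ultimately have *: "u q \<in> A" "d q \<in> A" using BA
        by (cases "u q \<in> B"; cases "d q \<in> B"; auto simp: B_def)+
      have "r (d p) = d q" using 1 V comm by simp
      moreover have "d q = r x \<or> d q = r (d x)" using edge'[of "d q"] * far V S_vert by simp
      ultimately have "d p = x \<or> d p = d x" using V by (metis closed(4) inv(2))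
      then have "p = u x \<or> p = x" using V by (metis inv(3))
      then show ?thesis using pne by simp
    next
      case 2
      \<comment> \<open>The left side of the stripe is intact, so leaving there gives up at least
        two bonds and regains none.\<close>
      have "r p \<in> A" "u p \<in> A" 
        using left_end[of p] left_end[of "u p"] far 2 inner V S_vert comm by simp_all
      then have "2 \<le> (of_bool (r q \<in> B) + of_bool (l q \<in> B) + of_bool (u q \<in> B) + of_bool (d q \<in> B) :: int)"
        using deg unfolding Bp by (auto simp: of_bool_def split: if_splits)
      moreover have "l q \<notin> A" "u q \<notin> A" "d q \<notin> A" 
        using left_end[of p] outer far 2 V S_vert comm by simp_all
      moreover have "r q \<notin> B" using 2 V unfolding B_def by simp
      ultimately show ?thesis using BA by simp
    qed
  qed
qed

text \<open>Starting from at most one displaced particle, a move of that particle or of the hole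
  preserves \<open>near\<close>. The energy bound enters when a second particle leaves
  \<open>S\<close>, and for moves out of a kink.\<close>

lemma trapped_step:
  assumes A: "trapped A" and p: "p \<in> A" and q: "q \<in> V - A" "q \<in> {r p, l p, u p, d p}"
    and e: "E (insert q (A - {p})) \<ge> E S - 3"
  shows "trapped (insert q (A - {p}))"
proof -
  note flip_both = wide_stripe.flip_vertical[OF flip_horizontal]
  consider (S) "A = S" | (one) x y where "x \<in> S" "y \<in> V - S" "A = insert y (S - {x})"
    | (kink) "kink r u d S A \<or> kink r d u S A \<or> kink l u d S A \<or> kink l d u S A"
    using A unfolding trapped_def near_def by blast
  then show ?thesis
  proof cases
    case S
    then have "near (insert q (A - {p}))" using p q(1) unfolding near_def by blast
    then show ?thesis unfolding trapped_def by blast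
  next
    case one
    have A_sub: "A \<subseteq> V" using one S_sub by auto
    consider (return) "p = y" "q = x" | (move) "p = y" "q \<notin> S" | (fill) "p \<in> S" "p \<noteq> y" "q = x"
      | (cross) "p \<in> S" "p \<noteq> x" "q \<notin> S" "q \<noteq> y"
      using one p q(1) by blast
    then show ?thesis
    proof cases
      case return
      then have "insert q (A - {p}) = S" using one by auto
      then show ?thesis unfolding trapped_def near_def by simp
    next
      case move
      then have "insert q (A - {p}) = insert q (S - {x})" using one by auto
      then show ?thesis unfolding trapped_def near_def using move one q(1) by blast
    next
      case fill
      then have "insert q (A - {p}) = insert y (S - {p})" using one p by auto
      then show ?thesis unfolding trapped_def near_def using fill one by blast
    next
      case cross
      have "p \<in> V" using p A_sub by auto
      \<comment> \<open>\<open>S\<close> is vertically invariant, so it can be left only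
        sideways.\<close>
      then have "q = r p \<or> q = l p" using q(2) cross S_vert by auto
      then show ?thesis
      proof
        assume "q = r p"
        then show ?thesis
          using second_defect[of x p y] one(1,2) cross q(1) e unfolding one(3) trapped_def by blast
      next
        assume "q = l p"
        then show ?thesis
          using wide_stripe.second_defect[OF flip_horizontal, of x p y] one(1,2) cross q(1) e unfolding one(3) trapped_def by blast
      qed
    qed
  next
    case kink
    have q': "q \<in> {r p, l p, d p, u p}" "q \<in> {l p, r p, u p, d p}" "q \<in> {l p, r p, d p, u p}"
      using q by auto
    note steps = kink_step[OF _ p q e] wide_stripe.kink_step[OF flip_vertical _ p q(1) q'(1) e]
      wide_stripe.kink_step[OF flip_horizontal _ p q(1) q'(2) e]
      wide_stripe.kink_step[OF flip_both _ p q(1) q'(3) e]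
    from kink show ?thesis
      unfolding trapped_def using steps by (elim disjE) metis+
  qed
qed

text \<open>This separates trapped sets from every stripe that misses three sites of
  \<open>S\<close>.\<close>

lemma card_trapped:
  assumes "trapped A"
  shows "card (S - A) \<le> 2"
proof -
  obtain x y where "S - A \<subseteq> {x, y}"
    using assms unfolding trapped_def near_def kink_def by blast
  then show ?thesis
    using card_mono[of "{x, y}" "S - A"] by (simp add: card_insert_if split: if_splits)
qed

end

section \<open>The torus\<close>

definition right :: "nat \<Rightarrow> site \<Rightarrow> site" where "right K x = ((fst x + 1) mod K, snd x)"
text \<open>Adding \<open>K - 1\<close> modulo \<open>K\<close> avoids truncated subtraction;
  \<open>down\<close> does the same with \<open>L\<close>.\<close>

definition left :: "nat \<Rightarrow> site \<Rightarrow> site" where "left K x = ((fst x + (K - 1)) mod K, snd x)"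
definition up :: "nat \<Rightarrow> site \<Rightarrow> site" where "up L x = (fst x, (snd x + 1) mod L)"
definition down :: "nat \<Rightarrow> site \<Rightarrow> site" where "down L x = (fst x, (snd x + (L - 1)) mod L)"

text \<open>Each bond is counted once, at its left or lower end point, so that sums run over sites
  instead of unordered pairs.\<close>

definition inner_bonds :: "nat \<Rightarrow> nat \<Rightarrow> site set \<Rightarrow> int" where
  "inner_bonds K L A = (\<Sum>x\<in>A. of_bool (right K x \<in> A) + of_bool (up L x \<in> A))"

definition occupied :: "nat \<Rightarrow> nat \<Rightarrow> config \<Rightarrow> site set" where
  "occupied K L \<eta> = {x \<in> sites K L. \<eta> x = 1}"

text \<open>For \<open>k \<le> K\<close>, the number of steps to the right that lead from column
  \<open>k\<close> to column \<open>a\<close>.\<close>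

definition offset :: "nat \<Rightarrow> nat \<Rightarrow> nat \<Rightarrow> nat" where "offset K k a = (a + (K - k)) mod K"

definition stripe_set :: "nat \<Rightarrow> nat \<Rightarrow> nat \<Rightarrow> nat \<Rightarrow> site set" where
  "stripe_set K L N0 k = {x \<in> sites K L. offset K k (fst x) < N0}"

section \<open>Cyclic arithmetic and bond counting on the torus\<close>

lemma succ_mod: "a < n \<Longrightarrow> Suc a mod n = (if a = n - 1 then 0 else Suc a)" for a n :: nat
  by (auto simp: mod_if)

lemma succ_mod_neq:
  fixes a n :: nat
  assumes "3 \<le> n" "a < n"
  shows "Suc a mod n \<noteq> a" "Suc (Suc a) mod n \<noteq> a"
  using assms by (auto simp: mod_Suc)

lemma pred_mod: "a < n \<Longrightarrow> (a + (n - 1)) mod n = (if a = 0 then n - 1 else a - 1)" for a n :: nat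
  by (auto simp: mod_if)

lemma succ_mod_eq_iff:
  fixes a b n :: nat
  assumes "a < n" "b < n"
  shows "(a + 1) mod n = b \<longleftrightarrow> a = (b + (n - 1)) mod n"
  unfolding pred_mod[OF assms(2)] using assms by (cases "a = n - 1") auto

lemma offset_less: "a < K \<Longrightarrow> offset K k a < K"
  unfolding offset_def by simp

lemma offset_succ: "offset K k ((a + 1) mod K) = (offset K k a + 1) mod K"
  unfolding offset_def by (simp add: mod_simps add_ac)

lemma offset_pred: "offset K k ((a + (K - 1)) mod K) = (offset K k a + (K - 1)) mod K"
proof -
  have "a + (K - 1) + (K - k) = a + (K - k) + (K - 1)" by simp
  then show ?thesis unfolding offset_def mod_add_left_eq by (simp only:)
qed

lemma finite_sites [simp]: "finite (sites K L)"
  unfolding sites_def by simp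

lemma shift_in_sites [simp]:
  assumes "x \<in> sites K L"
  shows "right K x \<in> sites K L" "left K x \<in> sites K L" "up L x \<in> sites K L" "down L x \<in> sites K L"
  using assms by (auto simp: right_def left_def up_def down_def sites_def)

lemma shift_eq_iff_shift_back:
  assumes "x \<in> sites K L" "y \<in> sites K L"
  shows "right K x = y \<longleftrightarrow> x = left K y" "up L x = y \<longleftrightarrow> x = down L y"
proof -
  have "fst x < K" "snd x < L" "fst y < K" "snd y < L"
    using assms by (auto simp: sites_def)
  then show "right K x = y \<longleftrightarrow> x = left K y" "up L x = y \<longleftrightarrow> x = down L y"
    unfolding right_def left_def up_def down_def prod_eq_iff
    by (auto simp: succ_mod_eq_iff simp del: One_nat_def add_Suc_right)
qed

lemma shift_neq:
  assumes "x \<in> sites K L" "3 \<le> K" "3 \<le> L"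
  shows "right K x \<noteq> x" "right K (right K x) \<noteq> x" "up L x \<noteq> x" "up L (up L x) \<noteq> x"
    "fst (right K x) \<noteq> fst x" "snd (up L x) \<noteq> snd x"
  using assms by (cases x; simp add: right_def up_def sites_def succ_mod_neq mod_Suc_eq)+

text \<open>The bonds of \<open>v\<close> to the right and upwards are counted at \<open>v\<close>;
  the other two are counted at \<open>left K v\<close> and \<open>down L v\<close>, which supplies
  the two additional sums over \<open>B\<close>.\<close>

lemma inner_bonds_insert:
  assumes K: "3 \<le> K" "3 \<le> L" and B: "B \<subseteq> sites K L" "v \<in> sites K L" "v \<notin> B"
  shows "inner_bonds K L (insert v B) = inner_bonds K L B +
    (of_bool (right K v \<in> B) + of_bool (left K v \<in> B) + of_bool (up L v \<in> B) + of_bool (down L v \<in> B))"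
proof -
  have fin: "finite B" using B(1) by (rule finite_subset) simp
  note v = shift_neq[OF B(2) K]
  have r: "right K x = v \<longleftrightarrow> x = left K v" and u: "up L x = v \<longleftrightarrow> x = down L v" if "x \<in> B" for x
    using shift_eq_iff_shift_back that B by blast+
  have "of_bool (right K x \<in> insert v B) + of_bool (up L x \<in> insert v B) =
    (of_bool (right K x \<in> B) + of_bool (up L x \<in> B)) + (if x = left K v then 1 else 0) + (if x = down L v then 1 else 0 :: int)"
    if "x \<in> B" for x
    using r[OF that] u[OF that] B(3) by auto
  then have "(\<Sum>x\<in>B. of_bool (right K x \<in> insert v B) + of_bool (up L x \<in> insert v B)) =
    (\<Sum>x\<in>B. of_bool (right K x \<in> B) + of_bool (up L x \<in> B)) + (\<Sum>x\<in>B. if x = left K v then 1 else 0)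
     + (\<Sum>x\<in>B. if x = down L v then 1 else 0 :: int)"
    by (simp add: sum.distrib)
  then show ?thesis
    unfolding inner_bonds_def using v fin B(3) by simp
qed

lemma bonds_eq:
  assumes "3 \<le> K" "3 \<le> L"
  shows "bonds K L = (\<lambda>x. {x, right K x}) ` sites K L \<union> (\<lambda>x. {x, up L x}) ` sites K L"
proof -
  have "x \<noteq> right K x" "x \<noteq> up L x" if "x \<in> sites K L" for x
    using shift_neq[OF that assms] by simp_all
  moreover have "bonds K L = {{x, y} | x y. x \<in> sites K L \<and> x \<noteq> y \<and> (y = right K x \<or> y = up L x)}"
    unfolding bonds_def right_def up_def by simp
  moreover have "(\<exists>x y. e = {x, y} \<and> x \<in> sites K L \<and> x \<noteq> y \<and> (y = right K x \<or> y = up L x)) \<longleftrightarrow>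
      (\<exists>x\<in>sites K L. e = {x, right K x}) \<or> (\<exists>x\<in>sites K L. e = {x, up L x})" for e
    using calculation(1,2) by metis
  ultimately show ?thesis
    unfolding image_def by (simp only:) blast
qed

text \<open>With sides of length at least three, two equal steps never return, so each family of
  bonds is indexed injectively by sites. The families are disjoint because a horizontal bond stays
  in one row and a vertical one does not.\<close>

lemma hamiltonian_eq:
  assumes K: "3 \<le> K" "3 \<le> L" and eta: "\<eta> \<in> sites K L \<rightarrow>\<^sub>E {0, 1}"
  shows "hamiltonian K L \<eta> = - inner_bonds K L (occupied K L \<eta>)"
proof -
  let ?V = "sites K L" and ?A = "occupied K L \<eta>"
  note shift = shift_neq[OF _ K]
  have "inj_on (\<lambda>x. {x, right K x}) ?V"
    by (rule inj_onI) (use shift(2) in \<open>auto simp: doubleton_eq_iff\<close>)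
  moreover have "inj_on (\<lambda>x. {x, up L x}) ?V"
    by (rule inj_onI) (use shift(4) in \<open>auto simp: doubleton_eq_iff\<close>)
  moreover have "{x, right K x} \<noteq> {y, up L y}" if "y \<in> ?V" for x y
  proof
    assume "{x, right K x} = {y, up L y}"
    then have "snd ` {x, right K x} = snd ` {y, up L y}" by (rule arg_cong)
    then show False using shift(6)[OF that] by (simp add: right_def doubleton_eq_iff)
  qed
  then have "(\<lambda>x. {x, right K x}) ` ?V \<inter> (\<lambda>x. {x, up L x}) ` ?V = {}"
    by blast
  ultimately have "(\<Sum>e\<in>bonds K L. \<Prod>x\<in>e. int (\<eta> x)) =
      (\<Sum>x\<in>?V. \<Prod>z\<in>{x, right K x}. int (\<eta> z)) + (\<Sum>x\<in>?V. \<Prod>z\<in>{x, up L x}. int (\<eta> z))"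
    unfolding bonds_eq[OF K] by (simp add: sum.union_disjoint sum.reindex)
  also have "\<dots> = (\<Sum>x\<in>?V. (\<Prod>z\<in>{x, right K x}. int (\<eta> z)) + (\<Prod>z\<in>{x, up L x}. int (\<eta> z)))"
    by (simp add: sum.distrib)
  also have "\<dots> = (\<Sum>x\<in>?V. if x \<in> ?A then of_bool (right K x \<in> ?A) + of_bool (up L x \<in> ?A) else 0)"
  proof (rule sum.cong[OF refl])
    fix x assume x: "x \<in> ?V"
    have val: "int (\<eta> z) = of_bool (z \<in> ?A)" if "z \<in> ?V" for z
      using PiE_mem[OF eta that] that unfolding occupied_def by auto
    show "(\<Prod>z\<in>{x, right K x}. int (\<eta> z)) + (\<Prod>z\<in>{x, up L x}. int (\<eta> z)) =
      (if x \<in> ?A then of_bool (right K x \<in> ?A) + of_bool (up L x \<in> ?A) else 0)"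
    proof -
      have "(\<Prod>z\<in>{x, right K x}. int (\<eta> z)) = int (\<eta> x) * int (\<eta> (right K x))"
        "(\<Prod>z\<in>{x, up L x}. int (\<eta> z)) = int (\<eta> x) * int (\<eta> (up L x))"
        using shift(1,3)[OF x] by (simp_all add: eq_commute[of x])
      then show ?thesis using val x by simp
    qed
  qed
  also have "\<dots> = (\<Sum>x\<in>?A. of_bool (right K x \<in> ?A) + of_bool (up L x \<in> ?A))"
    by (simp add: sum.inter_restrict[symmetric]) (rule sum.cong, auto simp: occupied_def)
  finally show ?thesis
    unfolding hamiltonian_def inner_bonds_def by simp
qed

text \<open>In \<open>offset\<close> coordinates the stripe is the interval of columns below
  \<open>N0\<close>. The bounds on \<open>N0\<close> give the stripe and its complement the width
  three required at both ends.\<close>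

lemma wide_stripe_torus:
  assumes L: "3 \<le> L" and N: "3 \<le> N0" "N0 + 3 \<le> K" and k: "k < K"
  shows "wide_stripe (sites K L) (right K) (left K) (up L) (down L) (stripe_set K L N0 k) (inner_bonds K L)"
proof -
  have K: "3 \<le> K" using N by simp
  have off: "offset K k (fst (right K x)) = (if offset K k (fst x) = K - 1 then 0 else offset K k (fst x) + 1)"
      "offset K k (fst (left K x)) = (if offset K k (fst x) = 0 then K - 1 else offset K k (fst x) - 1)"
    if "x \<in> sites K L" for x
  proof -
    have less: "offset K k (fst x) < K" using that by (auto simp: sites_def intro: offset_less)
    show "offset K k (fst (right K x)) = (if offset K k (fst x) = K - 1 then 0 else offset K k (fst x) + 1)"
      unfolding right_def fst_conv offset_succ using succ_mod[OF less] by simp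
    show "offset K k (fst (left K x)) = (if offset K k (fst x) = 0 then K - 1 else offset K k (fst x) - 1)"
      unfolding left_def fst_conv offset_pred by (rule pred_mod[OF less])
  qed
  have S: "x \<in> stripe_set K L N0 k \<longleftrightarrow> x \<in> sites K L \<and> offset K k (fst x) < N0" for x
    unfolding stripe_set_def by simp
  show ?thesis
  proof unfold_locales
    fix x assume x: "x \<in> sites K L"
    show "right K (left K x) = x" "left K (right K x) = x" "up L (down L x) = x" "down L (up L x) = x"
      using shift_eq_iff_shift_back[of "left K x" K L x] shift_eq_iff_shift_back[of x K L "right K x"]
        shift_eq_iff_shift_back[of "down L x" K L x] shift_eq_iff_shift_back[of x K L "up L x"] x by simp_all
    show "right K x \<noteq> x" "up L x \<noteq> x" "up L (up L x) \<noteq> x"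
      by (fact shift_neq[OF x K L])+
  next
    fix x assume x: "x \<in> stripe_set K L N0 k"
    show "left K x \<in> stripe_set K L N0 k \<and> left K (left K x) \<in> stripe_set K L N0 k \<and>
        right K (right K x) \<notin> stripe_set K L N0 k \<and> right K (right K (right K x)) \<notin> stripe_set K L N0 k"
      if "right K x \<notin> stripe_set K L N0 k"
      using x that N unfolding S by (auto simp: off split: if_splits)
    show "right K x \<in> stripe_set K L N0 k \<and> right K (right K x) \<in> stripe_set K L N0 k \<and>
        left K (left K x) \<notin> stripe_set K L N0 k \<and> left K (left K (left K x)) \<notin> stripe_set K L N0 k"
      if "left K x \<notin> stripe_set K L N0 k"
      using x that N unfolding S by (auto simp: off split: if_splits)
  next
    fix x assume "x \<in> sites K L"
    then show "right K x \<in> sites K L" "left K x \<in> sites K L" "up L x \<in> sites K L" "down L x \<in> sites K L"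
      by simp_all
  next
    fix x assume "x \<in> sites K L"
    then show "right K (up L x) = up L (right K x)" "right K (down L x) = down L (right K x)"
      "left K (up L x) = up L (left K x)" "left K (down L x) = down L (left K x)"
      "up L x \<in> stripe_set K L N0 k \<longleftrightarrow> x \<in> stripe_set K L N0 k"
      "down L x \<in> stripe_set K L N0 k \<longleftrightarrow> x \<in> stripe_set K L N0 k"
      by (auto simp: right_def left_def up_def down_def stripe_set_def sites_def)
  next
    show "stripe_set K L N0 k \<subseteq> sites K L" unfolding stripe_set_def by auto
  next
    fix B v assume "B \<subseteq> sites K L" "v \<in> sites K L" "v \<notin> B"
    then show "inner_bonds K L (insert v B) = inner_bonds K L B + (of_bool (right K v \<in> B) +
        of_bool (left K v \<in> B) + of_bool (up L v \<in> B) + of_bool (down L v \<in> B))"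
      by (rule inner_bonds_insert[OF K L])
  qed
qed

section \<open>Configurations as sets of occupied sites\<close>

definition config_of :: "nat \<Rightarrow> nat \<Rightarrow> site set \<Rightarrow> config" where
  "config_of K L A = (\<lambda>x\<in>sites K L. if x \<in> A then 1 else 0)"

definition neighbours :: "nat \<Rightarrow> nat \<Rightarrow> site \<Rightarrow> site set" where
  "neighbours K L x = {right K x, left K x, up L x, down L x}"

lemma config_of_PiE: "config_of K L A \<in> sites K L \<rightarrow>\<^sub>E {0, 1}"
  unfolding config_of_def by auto

lemma occupied_config_of: "A \<subseteq> sites K L \<Longrightarrow> occupied K L (config_of K L A) = A"
  unfolding occupied_def config_of_def by auto

lemma config_of_in_configs: "A \<subseteq> sites K L \<Longrightarrow> config_of K L A \<in> configs K L (card A)"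
proof -
  assume "A \<subseteq> sites K L"
  then have "(\<Sum>x\<in>sites K L. config_of K L A x) = card (sites K L \<inter> A)"
    unfolding config_of_def by (simp add: sum.If_cases)
  also have "sites K L \<inter> A = A" using \<open>A \<subseteq> sites K L\<close> by auto
  finally show ?thesis unfolding configs_def using config_of_PiE by auto
qed

lemma hamiltonian_config_of:
  "3 \<le> K \<Longrightarrow> 3 \<le> L \<Longrightarrow> A \<subseteq> sites K L \<Longrightarrow> hamiltonian K L (config_of K L A) = - inner_bonds K L A"
  using hamiltonian_eq[OF _ _ config_of_PiE] occupied_config_of by metis

lemma bond_iff:
  assumes "3 \<le> K" "3 \<le> L"
  shows "{x, y} \<in> bonds K L \<longleftrightarrow> x \<in> sites K L \<and> y \<in> neighbours K L x"
proof -
  have "{x, y} \<in> bonds K L \<longleftrightarrow>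
    x \<in> sites K L \<and> (y = right K x \<or> y = up L x) \<or> y \<in> sites K L \<and> (x = right K y \<or> x = up L y)"
    unfolding bonds_eq[OF assms] by (auto simp: doubleton_eq_iff)
  also have "\<dots> \<longleftrightarrow> x \<in> sites K L \<and> y \<in> neighbours K L x"
  proof (cases "x \<in> sites K L \<and> y \<in> sites K L")
    case True
    then show ?thesis
      unfolding neighbours_def
      using shift_eq_iff_shift_back[of y K L x] by auto
  next
    case False
    then show ?thesis unfolding neighbours_def by auto
  qed
  finally show ?thesis .
qed

lemma exchange_config_of:
  assumes "x \<in> A" "y \<in> sites K L - A" "A \<subseteq> sites K L"
  shows "exchange (config_of K L A) x y = config_of K L (insert y (A - {x}))"
  using assms unfolding exchange_def config_of_def by (auto simp: fun_eq_iff)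

lemma kawasaki_step_config_of:
  assumes "3 \<le> K" "3 \<le> L" "A \<subseteq> sites K L" "x \<in> A" "y \<in> sites K L - A" "y \<in> neighbours K L x"
  shows "kawasaki_step K L (config_of K L A) (config_of K L (insert y (A - {x})))"
proof -
  have "{x, y} \<in> bonds K L" using assms bond_iff by auto
  moreover have "config_of K L (insert y (A - {x})) y \<noteq> config_of K L A y"
    using assms unfolding config_of_def by auto
  ultimately show ?thesis
    unfolding kawasaki_step_def using exchange_config_of[OF assms(4,5,3)] by metis
qed

text \<open>An exchange that changes the configuration involves different values, so exactly one of
  the two sites is occupied; that one is \<open>p\<close>.\<close>

lemma kawasaki_step_occupied:
  assumes K: "3 \<le> K" "3 \<le> L" and eta: "\<eta> \<in> sites K L \<rightarrow>\<^sub>E {0, 1}" and step: "kawasaki_step K L \<eta> \<xi>"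
  obtains p q where "p \<in> occupied K L \<eta>" "q \<in> sites K L - occupied K L \<eta>" "q \<in> neighbours K L p"
    "occupied K L \<xi> = insert q (occupied K L \<eta> - {p})"
proof -
  obtain x y where xy: "{x, y} \<in> bonds K L" "\<xi> = exchange \<eta> x y" "\<xi> \<noteq> \<eta>"
    using step unfolding kawasaki_step_def by blast
  have V: "x \<in> sites K L" "y \<in> sites K L" "y \<in> neighbours K L x" "x \<in> neighbours K L y"
    using xy(1) bond_iff[OF K, of x y] bond_iff[OF K, of y x] by (simp_all add: insert_commute)
  have vals: "\<eta> x \<in> {0, 1}" "\<eta> y \<in> {0, 1}" using PiE_mem[OF eta] V by auto
  have "\<eta> x \<noteq> \<eta> y"
  proof
    assume "\<eta> x = \<eta> y"
    then have "\<xi> = \<eta>" using xy(2) unfolding exchange_def by (auto simp: fun_eq_iff)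
    then show False using xy(3) by simp
  qed
  then consider "\<eta> x = 1" "\<eta> y = 0" | "\<eta> x = 0" "\<eta> y = 1" using vals by auto
  then show thesis
  proof cases
    case 1
    show thesis
      by (rule that[of x y]) (use 1 V xy(2) in \<open>auto simp: occupied_def exchange_def split: if_splits\<close>)
  next
    case 2
    show thesis
      by (rule that[of y x]) (use 2 V xy(2) in \<open>auto simp: occupied_def exchange_def split: if_splits\<close>)
  qed
qed

section \<open>Stripes in cyclic column coordinates\<close>

lemma offset_add:
  assumes "i < K" "k < K"
  shows "offset K k ((k + i) mod K) = i"
proof -
  have "k + i + (K - k) = i + K" using assms by simp
  then show ?thesis unfolding offset_def mod_add_left_eq using assms by simp
qed

lemma add_offset:
  assumes "a < K" "k < K"
  shows "(k + offset K k a) mod K = a"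
proof -
  have "k + (a + (K - k)) = a + K" using assms by simp
  then show ?thesis unfolding offset_def mod_add_right_eq using assms by simp
qed

lemma stripe_set_eq_image:
  assumes "N0 \<le> K" "k < K"
  shows "stripe_set K L N0 k = (\<lambda>(i, j). ((k + i) mod K, j)) ` ({..<N0} \<times> {..<L})"
proof (intro equalityI subsetI)
  fix x assume x: "x \<in> stripe_set K L N0 k"
  then have "x = (\<lambda>(i, j). ((k + i) mod K, j)) (offset K k (fst x), snd x)"
    using add_offset[of "fst x" K k] assms by (auto simp: stripe_set_def sites_def)
  moreover have "(offset K k (fst x), snd x) \<in> {..<N0} \<times> {..<L}"
    using x by (auto simp: stripe_set_def sites_def)
  ultimately show "x \<in> (\<lambda>(i, j). ((k + i) mod K, j)) ` ({..<N0} \<times> {..<L})" by blast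
next
  fix x assume "x \<in> (\<lambda>(i, j). ((k + i) mod K, j)) ` ({..<N0} \<times> {..<L})"
  then show "x \<in> stripe_set K L N0 k"
    using assms by (auto simp: stripe_set_def sites_def offset_add)
qed

lemma inj_on_stripe:
  fixes N0 K k :: nat and B :: "nat set"
  assumes "N0 \<le> K" "k < K"
  shows "inj_on (\<lambda>(i, j). ((k + i) mod K, j)) ({..<N0} \<times> B)"
  by (rule inj_on_inverseI[where g = "\<lambda>x :: site. (offset K k (fst x), snd x)"])
    (use assms in \<open>auto simp: offset_add\<close>)

lemma card_stripe_set: "N0 \<le> K \<Longrightarrow> k < K \<Longrightarrow> card (stripe_set K L N0 k) = L * N0"
  by (simp add: stripe_set_eq_image card_image inj_on_stripe card_cartesian_product)

lemma stripe_set_subset: "stripe_set K L N0 k \<subseteq> sites K L"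
  unfolding stripe_set_def by auto

lemma stripe_eq:
  assumes "N0 \<le> K" "k < K"
  shows "stripe K L N0 k = config_of K L (stripe_set K L N0 k)"
proof -
  have "x \<in> (\<Union>m<N0. column L ((k + m) mod K)) \<longleftrightarrow> x \<in> stripe_set K L N0 k" for x
    unfolding stripe_set_eq_image[OF assms] column_def by (cases x) auto
  then show ?thesis unfolding stripe_def config_of_def by presburger
qed

text \<open>Every particle owns its upward bond, and all particles outside the last column own the
  bond to their right. This gives \<open>L * (2 * N0 - 1)\<close> bonds.\<close>

lemma inner_bonds_stripe_set:
  assumes "N0 < K" "k < K" "1 \<le> N0"
  shows "inner_bonds K L (stripe_set K L N0 k) = - ground_energy L N0"
proof -
  let ?S = "stripe_set K L N0 k"
  have *: "of_bool (right K ((k + i) mod K, j) \<in> ?S) + of_bool (up L ((k + i) mod K, j) \<in> ?S) =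
      (if i < N0 - 1 then 1 else 0) + (1 :: int)" if "i < N0" "j < L" for i j
  proof -
    have "right K ((k + i) mod K, j) \<in> ?S \<longleftrightarrow> i < N0 - 1"
      using that assms offset_add[of "i + 1" K k] by (auto simp: right_def stripe_set_def sites_def mod_simps)
    moreover have "up L ((k + i) mod K, j) \<in> ?S"
      using that assms offset_add[of i K k] by (auto simp: up_def stripe_set_def sites_def)
    ultimately show ?thesis by simp
  qed
  have reindex: "sum f ?S = (\<Sum>(i, j)\<in>{..<N0} \<times> {..<L}. f ((k + i) mod K, j))" for f :: "site \<Rightarrow> int"
    unfolding stripe_set_eq_image[OF less_imp_le[OF assms(1)] assms(2)]
    using sum.reindex[OF inj_on_stripe[OF less_imp_le[OF assms(1)] assms(2), of "{..<L}"], of f]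
    by (simp add: case_prod_unfold comp_def)
  have "inner_bonds K L ?S = (\<Sum>(i, j)\<in>{..<N0} \<times> {..<L}.
      of_bool (right K ((k + i) mod K, j) \<in> ?S) + of_bool (up L ((k + i) mod K, j) \<in> ?S))"
    unfolding inner_bonds_def by (rule reindex)
  also have "\<dots> = (\<Sum>(i, j)\<in>{..<N0} \<times> {..<L}. (if i < N0 - 1 then 1 else 0) + (1 :: int))"
    by (rule sum.cong) (use * in auto)
  also have "\<dots> = (\<Sum>i<N0. \<Sum>j<L. (if i < N0 - 1 then 1 else 0) + (1 :: int))"
    by (rule sum.cartesian_product[symmetric])
  also have "\<dots> = int L * (\<Sum>i<N0. (if i < N0 - 1 then 1 else 0) + (1 :: int))"
    by (simp add: sum_distrib_left)
  also have "(\<Sum>i<N0. (if i < N0 - 1 then 1 else 0) + (1 :: int)) = 2 * int N0 - 1"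
  proof -
    have "{i. i < N0 \<and> i < N0 - 1} = {..<N0 - 1}" by auto
    then show ?thesis using assms by (simp add: sum.distrib sum.If_cases Int_def)
  qed
  finally show ?thesis by (simp add: ground_energy_def algebra_simps)
qed

section \<open>Lower bound\<close>

text \<open>A whole column of the first stripe avoids the second: either its first column
  \<open>k\<close> or its last column, at offset \<open>N0 - 1\<close>.\<close>

lemma card_stripe_set_Diff:
  assumes "2 * N0 < K" "1 \<le> N0" "k < K" "k' < K" "k \<noteq> k'"
  shows "L \<le> card (stripe_set K L N0 k - stripe_set K L N0 k')"
proof -
  have "\<exists>a<K. offset K k a < N0 \<and> N0 \<le> offset K k' a"
  proof (cases "N0 \<le> offset K k' k")
    case True
    moreover have "offset K k k = 0" using offset_add[of 0 K k] assms by simp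
    ultimately show ?thesis using assms by (intro exI[of _ k]) simp
  next
    case False
    define a where "a = (k + (N0 - 1)) mod K"
    have "a < K" unfolding a_def using assms by simp
    moreover have "offset K k a = N0 - 1" unfolding a_def by (rule offset_add) (use assms in auto)
    moreover have "offset K k' a = (offset K k' k + (N0 - 1)) mod K"
      unfolding a_def offset_def mod_add_left_eq by (simp only: add_ac)
    \<comment> \<open>With a positive offset below \<open>N0\<close> for column \<open>k\<close>,
      the last column has offset at least \<open>N0\<close> from \<open>k'\<close>, and
      \<open>2 * N0 < K\<close> prevents wrapping around.\<close>
    moreover have "offset K k' k \<noteq> 0"
      using add_offset[of k K k'] assms by (intro notI) simp
    ultimately have "a < K \<and> offset K k a < N0 \<and> N0 \<le> offset K k' a"
      using False assms by simp
    then show ?thesis by blast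
  qed
  then obtain a where a: "a < K" "offset K k a < N0" "N0 \<le> offset K k' a" by blast
  then have "{a} \<times> {..<L} \<subseteq> stripe_set K L N0 k - stripe_set K L N0 k'"
    by (auto simp: stripe_set_def sites_def)
  moreover have "finite (stripe_set K L N0 k - stripe_set K L N0 k')"
    using finite_subset[OF stripe_set_subset finite_sites] by blast
  ultimately have "card ({a} \<times> {..<L}) \<le> card (stripe_set K L N0 k - stripe_set K L N0 k')"
    by (rule card_mono[rotated])
  then show ?thesis by simp
qed

text \<open>Along a lower path every occupied set would be trapped, but the target stripe misses at
  least \<open>L \<ge> 3\<close> sites of the initial one.\<close>

lemma path_height_lower:
  assumes L: "3 \<le> L" and N: "3 \<le> N0" "2 * N0 < K" and k: "k < K" "k' < K" "k \<noteq> k'"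
    and path: "is_path K L (L * N0) (stripe K L N0 k) (stripe K L N0 k') \<omega>"
  shows "ground_energy L N0 + 4 \<le> path_height K L \<omega>"
proof (rule ccontr)
  assume low: "\<not> ?thesis"
  have K: "3 \<le> K" using N by simp
  have N_le: "N0 \<le> K" using N by simp
  let ?S = "stripe_set K L N0"
  interpret wide_stripe "sites K L" "right K" "left K" "up L" "down L" "?S k" "inner_bonds K L"
    using N by (intro wide_stripe_torus) (use L k in auto)
  have S_energy: "inner_bonds K L (?S k) = - ground_energy L N0"
    by (rule inner_bonds_stripe_set) (use N k in auto)
  \<comment> \<open>Energies are integers, so staying below the barrier means losing at most three
    bonds.\<close>
  have mem: "\<eta> \<in> sites K L \<rightarrow>\<^sub>E {0, 1}" "- ground_energy L N0 - 3 \<le> inner_bonds K L (occupied K L \<eta>)"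
    if "\<eta> \<in> set \<omega>" for \<eta>
  proof -
    show eta: "\<eta> \<in> sites K L \<rightarrow>\<^sub>E {0, 1}"
      using that path unfolding is_path_def configs_def by blast
    have "hamiltonian K L \<eta> \<le> path_height K L \<omega>"
      unfolding path_height_def using that by simp
    then show "- ground_energy L N0 - 3 \<le> inner_bonds K L (occupied K L \<eta>)"
      using low hamiltonian_eq[OF K L eta] by linarith
  qed
  have "trapped (occupied K L (\<omega> ! i))" if "i < length \<omega>" for i
    using that
  proof (induction i)
    case 0
    then have "\<omega> ! 0 = stripe K L N0 k" using path unfolding is_path_def by (metis hd_conv_nth)
    then have "occupied K L (\<omega> ! 0) = ?S k"
      using stripe_eq[OF N_le k(1)] occupied_config_of[OF stripe_set_subset] by metis
    then show ?case unfolding trapped_def near_def by simp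
  next
    case (Suc i)
    then have in_path: "\<omega> ! i \<in> set \<omega>" "\<omega> ! Suc i \<in> set \<omega>" by simp_all
    have "kawasaki_step K L (\<omega> ! i) (\<omega> ! Suc i)"
      using path Suc.prems unfolding is_path_def by blast
    then obtain p q where pq: "p \<in> occupied K L (\<omega> ! i)" "q \<in> sites K L - occupied K L (\<omega> ! i)"
      "q \<in> neighbours K L p" "occupied K L (\<omega> ! Suc i) = insert q (occupied K L (\<omega> ! i) - {p})"
      by (rule kawasaki_step_occupied[OF K L mem(1)[OF in_path(1)]])
    show ?case unfolding pq(4)
    proof (rule trapped_step)
      show "trapped (occupied K L (\<omega> ! i))" using Suc by simp
      show "inner_bonds K L (insert q (occupied K L (\<omega> ! i) - {p})) \<ge> inner_bonds K L (?S k) - 3"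
        using mem(2)[OF in_path(2)] pq(4) S_energy by simp
    qed (use pq in \<open>auto simp: neighbours_def\<close>)
  qed
  from this[of "length \<omega> - 1"] have "trapped (occupied K L (stripe K L N0 k'))"
    using path unfolding is_path_def by (metis last_conv_nth diff_less length_greater_0_conv zero_less_one)
  then have "trapped (?S k')"
    using stripe_eq[OF N_le k(2)] occupied_config_of[OF stripe_set_subset] by metis
  then have "card (?S k - ?S k') \<le> 2" by (rule card_trapped)
  moreover have "L \<le> card (?S k - ?S k')"
    by (rule card_stripe_set_Diff) (use N k in auto)
  ultimately show False using L by simp
qed

section \<open>Upper bound\<close>

text \<open>One particle move between occupied sets. The bound concerns only the set reached, so the
  first set of a chain has to be checked separately.\<close>

definition low_hop :: "nat \<Rightarrow> nat \<Rightarrow> int \<Rightarrow> site set \<Rightarrow> site set \<Rightarrow> bool" where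
  "low_hop K L b A B \<longleftrightarrow> A \<subseteq> sites K L \<and> b \<le> inner_bonds K L B \<and>
     (\<exists>p\<in>A. \<exists>q\<in>sites K L - A. q \<in> neighbours K L p \<and> B = insert q (A - {p}))"

lemma low_hop_rtranclp:
  assumes "(low_hop K L b)\<^sup>*\<^sup>* A B" "A \<subseteq> sites K L" "b \<le> inner_bonds K L A" "3 \<le> K" "3 \<le> L"
  shows "B \<subseteq> sites K L \<and> card B = card A \<and>
    (\<exists>\<omega>. is_path K L (card A) (config_of K L A) (config_of K L B) \<omega> \<and> (\<forall>\<eta>\<in>set \<omega>. hamiltonian K L \<eta> \<le> - b))"
  using assms(1)
proof (induction rule: rtranclp_induct)
  case base
  have "is_path K L (card A) (config_of K L A) (config_of K L A) [config_of K L A]"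
    unfolding is_path_def using config_of_in_configs assms by auto
  moreover have "hamiltonian K L (config_of K L A) \<le> - b"
    using hamiltonian_config_of assms by simp
  ultimately show ?case using assms by force
next
  case (step B C)
  then obtain \<omega> where \<omega>: "is_path K L (card A) (config_of K L A) (config_of K L B) \<omega>"
    "\<forall>\<eta>\<in>set \<omega>. hamiltonian K L \<eta> \<le> - b" and B: "B \<subseteq> sites K L" "card B = card A"
    by blast
  obtain p q where pq: "p \<in> B" "q \<in> sites K L - B" "q \<in> neighbours K L p" "C = insert q (B - {p})"
    and b: "b \<le> inner_bonds K L C"
    using step.hyps unfolding low_hop_def by blast
  have C: "C \<subseteq> sites K L" "card C = card A"
  proof -
    show "C \<subseteq> sites K L" using pq B by auto
    have "finite B" using B(1) by (rule finite_subset) simp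
    then show "card C = card A"
      using pq B card_Suc_Diff1[of B p] by simp
  qed
  have kstep: "kawasaki_step K L (config_of K L B) (config_of K L C)"
    unfolding pq(4) by (rule kawasaki_step_config_of) (use assms B pq in auto)
  have "is_path K L (card A) (config_of K L A) (config_of K L C) (\<omega> @ [config_of K L C])"
    unfolding is_path_def
  proof (intro conjI allI impI)
    show "set (\<omega> @ [config_of K L C]) \<subseteq> configs K L (card A)"
      using \<omega>(1) config_of_in_configs[OF C(1)] C(2) unfolding is_path_def by auto
    fix i assume i: "Suc i < length (\<omega> @ [config_of K L C])"
    show "kawasaki_step K L ((\<omega> @ [config_of K L C]) ! i) ((\<omega> @ [config_of K L C]) ! Suc i)"
    proof (cases "Suc i < length \<omega>")
      case True
      then show ?thesis using \<omega>(1) unfolding is_path_def by (simp add: nth_append)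
    next
      case False
      then have "Suc i = length \<omega>" using i by simp
      moreover from this have "\<omega> ! i = config_of K L B"
        using \<omega>(1) unfolding is_path_def by (metis last_conv_nth diff_Suc_1)
      ultimately show ?thesis using kstep by (simp add: nth_append)
    qed
  qed (use \<omega>(1) in \<open>auto simp: is_path_def\<close>)
  moreover have "hamiltonian K L (config_of K L C) \<le> - b"
    using hamiltonian_config_of[OF assms(4,5) C(1)] b by simp
  ultimately show ?case using C \<omega>(2)
    by (intro conjI exI[of _ "\<omega> @ [config_of K L C]"]) auto
qed

text \<open>The set after \<open>m\<close> rows have been shifted: column \<open>k\<close> has lost
  its lowest \<open>m\<close> sites, and the column at offset \<open>N0\<close> has received
  them.\<close>

definition growing_stripe :: "nat \<Rightarrow> nat \<Rightarrow> nat \<Rightarrow> nat \<Rightarrow> nat \<Rightarrow> site set" where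
  "growing_stripe K L N0 k m = {x \<in> sites K L. offset K k (fst x) \<le> N0 \<and>
     (offset K k (fst x) = 0 \<longrightarrow> m \<le> snd x) \<and> (offset K k (fst x) = N0 \<longrightarrow> snd x < m)}"

section \<open>Transport of one column across the stripe\<close>

context
  fixes K L N0 k :: nat
  assumes L: "3 \<le> L" and N: "3 \<le> N0" "2 * N0 < K" and k: "k < K"
begin

abbreviation (input) "cell i j \<equiv> ((k + i) mod K, j)"

lemma K_ge_3: "3 \<le> K" using N by simp

lemma cell_in_sites: "j < L \<Longrightarrow> cell i j \<in> sites K L"
  using k by (auto simp: sites_def)

lemma cell_in_growing_stripe:
  assumes "i < K" "j < L"
  shows "cell i j \<in> growing_stripe K L N0 k m \<longleftrightarrow> i \<le> N0 \<and> (i = 0 \<longrightarrow> m \<le> j) \<and> (i = N0 \<longrightarrow> j < m)"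
  using cell_in_sites[OF assms(2), of i] offset_add[OF assms(1) k]
  unfolding growing_stripe_def by simp

lemma cell_eq_iff: "i < K \<Longrightarrow> i' < K \<Longrightarrow> cell i j = cell i' j' \<longleftrightarrow> i = i' \<and> j = j'"
  using offset_add k by (metis prod.inject)

lemma right_cell: "right K (cell i j) = cell (i + 1) j"
  unfolding right_def by (simp add: mod_simps)

lemma left_cell: "j < L \<Longrightarrow> left K (cell (i + 1) j) = cell i j"
  using shift_eq_iff_shift_back(1)[of "cell i j" K L "cell (i + 1) j"] cell_in_sites right_cell by metis

lemma left_cell_0:
  assumes "j < L"
  shows "left K (cell 0 j) = cell (K - 1) j"
proof -
  have "cell (K - 1 + 1) j = cell 0 j" using K_ge_3 by simp
  then show ?thesis using left_cell[OF assms, of "K - 1"] by simp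
qed

lemma down_cell: "j + 1 < L \<Longrightarrow> down L (cell i (j + 1)) = cell i j"
  using shift_eq_iff_shift_back(2)[of "cell i j" K L "cell i (j + 1)"] cell_in_sites[of j i] cell_in_sites[of "j + 1" i]
  by (simp add: up_def)

lemma growing_stripe_0: "growing_stripe K L N0 k 0 = stripe_set K L N0 k"
  unfolding growing_stripe_def stripe_set_def using N by auto

text \<open>Measured from column \<open>k + 1\<close> instead of \<open>k\<close>, every offset
  drops by one cyclically, so offsets \<open>1\<close> to \<open>N0\<close> become \<open>0\<close>
  to \<open>N0 - 1\<close>.\<close>

lemma growing_stripe_L: "growing_stripe K L N0 k L = stripe_set K L N0 ((k + 1) mod K)"
proof -
  have "offset K ((k + 1) mod K) a = (offset K k a + (K - 1)) mod K" if a: "a < K" for a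
  proof -
    have "(k + 1) mod K < K" using k by simp
    moreover have "((k + 1) mod K + (offset K k a + (K - 1))) mod K = a"
    proof -
      have "k + 1 + (offset K k a + (K - 1)) = k + offset K k a + K" using K_ge_3 by simp
      then show ?thesis using add_offset[OF a k] by (simp only: mod_add_left_eq mod_add_self2)
    qed
    moreover have "((k + 1) mod K + (offset K k a + (K - 1)) mod K) mod K
        = ((k + 1) mod K + (offset K k a + (K - 1))) mod K"
      by (rule mod_add_right_eq)
    ultimately show ?thesis
      using offset_add[of "(offset K k a + (K - 1)) mod K" K "(k + 1) mod K"] k by simp
  qed
  then have "offset K ((k + 1) mod K) a = (if offset K k a = 0 then K - 1 else offset K k a - 1)" if "a < K" for a
    using that pred_mod[OF offset_less[OF that]] by simp
  then have "x \<in> growing_stripe K L N0 k L \<longleftrightarrow> x \<in> stripe_set K L N0 ((k + 1) mod K)" for x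
    unfolding growing_stripe_def stripe_set_def using N by (auto simp: sites_def split: if_splits)
  then show ?thesis by blast
qed

text \<open>Measure \<open>E\<close> relative to the ground state. Filling \<open>cell N0 m\<close>
  gains at least one bond for \<open>m = 0\<close> and two later; a hole in the row costs at most
  four, and at \<open>cell 0 m\<close> at most three for \<open>m = 0\<close> and two later. So the
  hops stay at \<open>-4\<close> or above and the finished row at \<open>-2\<close> or
  above.\<close>

lemma growing_stripe_step:
  assumes m: "m < L" and e: "if m = 0 then - ground_energy L N0 \<le> inner_bonds K L (growing_stripe K L N0 k m)
      else - ground_energy L N0 - 2 \<le> inner_bonds K L (growing_stripe K L N0 k m)"
  shows "(low_hop K L (- ground_energy L N0 - 4))\<^sup>*\<^sup>* (growing_stripe K L N0 k m) (growing_stripe K L N0 k (Suc m))"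
    and "- ground_energy L N0 - 2 \<le> inner_bonds K L (growing_stripe K L N0 k (Suc m))"
proof -
  let ?E = "inner_bonds K L" and ?A = "growing_stripe K L N0 k"
  \<comment> \<open>\<open>C\<close> has one particle too many. Every set visited within the row is
    \<open>C\<close> with a hole at some \<open>cell t m\<close>, which allows one estimate for all
    of them.\<close>
  define C where "C = insert (cell N0 m) (?A m)"
  define D where "D t = C - {cell t m}" for t
  have A_sub: "?A m \<subseteq> sites K L" for m unfolding growing_stripe_def by auto
  have C_sub: "C \<subseteq> sites K L" unfolding C_def using A_sub cell_in_sites[OF m] by auto
  have new: "cell N0 m \<notin> ?A m" using cell_in_growing_stripe[of N0 m m] N m by simp
  have C_row: "cell t m \<in> C" if "t \<le> N0" for t
    using that cell_in_growing_stripe[of t m m] N m unfolding C_def by auto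
  have "(of_bool (right K (cell N0 m) \<in> ?A m) + of_bool (left K (cell N0 m) \<in> ?A m) +
      of_bool (up L (cell N0 m) \<in> ?A m) + of_bool (down L (cell N0 m) \<in> ?A m)) \<ge> (if m = 0 then 1 else 2 :: int)"
  proof -
    have "left K (cell N0 m) \<in> ?A m"
      using left_cell[OF m, of "N0 - 1"] cell_in_growing_stripe[of "N0 - 1" m m] N m by simp
    moreover have "down L (cell N0 m) \<in> ?A m" if "m \<noteq> 0"
      using down_cell[of "m - 1" N0] cell_in_growing_stripe[of N0 "m - 1" m] N m that by simp
    ultimately show ?thesis by auto
  qed
  then have E_C: "?E C \<ge> ?E (?A m) + (if m = 0 then 1 else 2)"
    using inner_bonds_insert[OF K_ge_3 L A_sub cell_in_sites[OF m] new] unfolding C_def by linarith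
  have E_D: "?E C = ?E (D t) + (of_bool (right K (cell t m) \<in> D t) + of_bool (left K (cell t m) \<in> D t) +
      of_bool (up L (cell t m) \<in> D t) + of_bool (down L (cell t m) \<in> D t))" if "t \<le> N0" for t
  proof -
    have "D t \<subseteq> sites K L" "cell t m \<notin> D t" using C_sub unfolding D_def by auto
    moreover have "insert (cell t m) (D t) = C" using C_row[OF that] unfolding D_def by auto
    ultimately show ?thesis using inner_bonds_insert[OF K_ge_3 L _ cell_in_sites[OF m], of "D t" t] by simp
  qed
  have E_D4: "?E (D t) \<ge> - ground_energy L N0 - 4" if "t \<le> N0" for t
  proof -
    have "of_bool b \<le> (1 :: int)" for b by simp
    from this[of "right K (cell t m) \<in> D t"] this[of "left K (cell t m) \<in> D t"]
      this[of "up L (cell t m) \<in> D t"] this[of "down L (cell t m) \<in> D t"]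
    have "?E C \<le> ?E (D t) + 4" using E_D[OF that] by linarith
    then show ?thesis using E_C e by (auto split: if_splits)
  qed
  have D_0: "D 0 = ?A (Suc m)"
  proof (rule set_eqI)
    fix x
    show "x \<in> D 0 \<longleftrightarrow> x \<in> ?A (Suc m)"
    proof (cases "x \<in> sites K L")
      case True
      then have x: "x = cell (offset K k (fst x)) (snd x)" and less: "offset K k (fst x) < K" "snd x < L"
        using add_offset[of "fst x" K k] k offset_less by (auto simp: sites_def)
      define i where "i = offset K k (fst x)"
      define j where "j = snd x"
      have ij: "x = cell i j" "i < K" "j < L" using x less unfolding i_def j_def by simp_all
      have "0 < K" "N0 < K" using N by auto
      have "cell i j = cell 0 m \<longleftrightarrow> i = 0 \<and> j = m" "cell i j = cell N0 m \<longleftrightarrow> i = N0 \<and> j = m"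
        by (fact cell_eq_iff[OF ij(2) \<open>0 < K\<close>] cell_eq_iff[OF ij(2) \<open>N0 < K\<close>])+
      then have "x \<in> D 0 \<longleftrightarrow> (i = N0 \<and> j = m \<or> cell i j \<in> ?A m) \<and> \<not> (i = 0 \<and> j = m)"
        unfolding ij(1) D_def C_def by blast
      then show ?thesis
        unfolding ij(1) cell_in_growing_stripe[OF ij(2,3)] using N by auto
    qed (use C_sub A_sub in \<open>auto simp: D_def\<close>)
  qed
  have first: "low_hop K L (- ground_energy L N0 - 4) (?A m) (D (N0 - 1))"
  proof -
    have "cell N0 m \<in> neighbours K L (cell (N0 - 1) m)"
      using right_cell[of "N0 - 1" m] N unfolding neighbours_def by simp
    moreover have "cell (N0 - 1) m \<in> ?A m"
      using cell_in_growing_stripe[of "N0 - 1" m m] N m by simp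
    moreover have "cell N0 m \<noteq> cell (N0 - 1) m" using cell_eq_iff[of N0 "N0 - 1" m m] N by auto
    then have "D (N0 - 1) = insert (cell N0 m) (?A m - {cell (N0 - 1) m})"
      unfolding D_def C_def by auto
    moreover have "cell N0 m \<in> sites K L - ?A m" using new cell_in_sites[OF m] by blast
    moreover have "- ground_energy L N0 - 4 \<le> ?E (D (N0 - 1))" using E_D4 by simp
    ultimately show ?thesis unfolding low_hop_def using A_sub by blast
  qed
  have hole: "low_hop K L (- ground_energy L N0 - 4) (D (Suc t)) (D t)" if "Suc t < N0" for t
  proof -
    have "cell (Suc t) m \<in> neighbours K L (cell t m)"
      using right_cell[of t m] unfolding neighbours_def by simp
    moreover have ne: "cell t m \<noteq> cell (Suc t) m" using cell_eq_iff[of t "Suc t" m m] N that by auto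
    then have "cell t m \<in> D (Suc t)"
      unfolding D_def using C_row that by auto
    moreover have "D t = insert (cell (Suc t) m) (D (Suc t) - {cell t m})"
      using ne C_row[of "Suc t"] that unfolding D_def by auto
    moreover have "cell (Suc t) m \<in> sites K L - D (Suc t)"
      unfolding D_def using cell_in_sites[OF m] by blast
    moreover have "D (Suc t) \<subseteq> sites K L" unfolding D_def using C_sub by blast
    moreover have "- ground_energy L N0 - 4 \<le> ?E (D t)" using E_D4 that by simp
    ultimately show ?thesis unfolding low_hop_def by blast
  qed
  \<comment> \<open>The hole starts at \<open>N0 - 1\<close>, where the end particle was pushed out,
    and moves left until it reaches \<open>0\<close>.\<close>
  have "(low_hop K L (- ground_energy L N0 - 4))\<^sup>*\<^sup>* (?A m) (D (N0 - 1 - t))" if "t < N0" for t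
    using that
  proof (induction t)
    case 0
    then show ?case using first by simp
  next
    case (Suc t)
    then have "N0 - 1 - t = Suc (N0 - 1 - Suc t)" "Suc (N0 - 1 - Suc t) < N0" by simp_all
    then show ?case using Suc hole[of "N0 - 1 - Suc t"] by (metis Suc_lessD rtranclp.rtrancl_into_rtrancl)
  qed
  from this[of "N0 - 1"] show "(low_hop K L (- ground_energy L N0 - 4))\<^sup>*\<^sup>* (?A m) (?A (Suc m))"
    using N unfolding D_0[symmetric] by simp
  have "(of_bool (right K (cell 0 m) \<in> D 0) + of_bool (left K (cell 0 m) \<in> D 0) +
      of_bool (up L (cell 0 m) \<in> D 0) + of_bool (down L (cell 0 m) \<in> D 0)) \<le> (if m = 0 then 3 else 2 :: int)"
  proof -
    \<comment> \<open>The site on the left has offset \<open>K - 1\<close>, beyond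
      \<open>N0\<close>. The site below was emptied earlier, except for \<open>m = 0\<close>, where
      it wraps around to the top row.\<close>
    have "left K (cell 0 m) \<notin> D 0"
      using left_cell_0[OF m] cell_in_growing_stripe[of "K - 1" m "Suc m"] N m unfolding D_0 by simp
    moreover have "down L (cell 0 m) \<notin> D 0" if "m \<noteq> 0"
      using down_cell[of "m - 1" 0] cell_in_growing_stripe[of 0 "m - 1" "Suc m"] N m that unfolding D_0 by simp
    ultimately show ?thesis by auto
  qed
  then show "- ground_energy L N0 - 2 \<le> ?E (?A (Suc m))"
    using E_D[of 0] E_C e unfolding D_0[symmetric] by (auto split: if_splits)
qed

lemma stripe_shift:
  "(low_hop K L (- ground_energy L N0 - 4))\<^sup>*\<^sup>* (stripe_set K L N0 k) (stripe_set K L N0 ((k + 1) mod K))"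
proof -
  let ?A = "growing_stripe K L N0 k"
  have e0: "- ground_energy L N0 \<le> inner_bonds K L (?A 0)"
    unfolding growing_stripe_0 using inner_bonds_stripe_set[of N0 K k L] N k by simp
  have "(if m = 0 then - ground_energy L N0 \<le> inner_bonds K L (?A m)
      else - ground_energy L N0 - 2 \<le> inner_bonds K L (?A m)) \<and>
    (low_hop K L (- ground_energy L N0 - 4))\<^sup>*\<^sup>* (?A 0) (?A m)" if "m \<le> L" for m
    using that
  proof (induction m)
    case 0
    then show ?case using e0 by simp
  next
    case (Suc m)
    then have "m < L" "m \<le> L" by simp_all
    then show ?case using growing_stripe_step[of m] Suc.IH
      by (metis (no_types, lifting) nat.simps(3) rtranclp_trans)
  qed
  from this[of L] show ?thesis unfolding growing_stripe_0 growing_stripe_L by simp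
qed

end

theorem theorem3p4:
  fixes K L N0 k k' :: nat
  assumes "L < K" and "3 \<le> L"
    and "real L / 4 < real N0" and "real N0 < real K / 2" and "3 \<le> N0"
    and "k \<in> {..<K}" and "k' \<in> {..<K}" and "k \<noteq> k'"
  shows "comm_height K L (L * N0) (stripe K L N0 k) (stripe K L N0 k') = ground_energy L N0 + 4"
proof -
  have N: "2 * N0 < K" "3 \<le> K" "N0 \<le> K" using assms by linarith+
  have k: "k < K" "k' < K" using assms by auto
  let ?S = "stripe_set K L N0" and ?b = "- ground_energy L N0 - 4"
  \<comment> \<open>Shifting always to the right is enough: \<open>offset K k k'\<close> shifts lead
    from \<open>k\<close> to \<open>k'\<close>.\<close>
  have "(low_hop K L ?b)\<^sup>*\<^sup>* (?S k) (?S ((k + i) mod K))" for i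
  proof (induction i)
    case 0
    then show ?case using k by simp
  next
    case (Suc i)
    have "(low_hop K L ?b)\<^sup>*\<^sup>* (?S ((k + i) mod K)) (?S (((k + i) mod K + 1) mod K))"
      by (rule stripe_shift) (use assms N in auto)
    then show ?case using Suc by (simp add: mod_simps)
  qed
  from this[of "offset K k k'"] have reach: "(low_hop K L ?b)\<^sup>*\<^sup>* (?S k) (?S k')"
    using add_offset[of k' K k] k by simp
  have "?b \<le> inner_bonds K L (?S k)"
    using inner_bonds_stripe_set[of N0 K k L] assms N k by simp
  from low_hop_rtranclp[OF reach stripe_set_subset this N(2) assms(2)]
  obtain \<omega> where path: "is_path K L (L * N0) (stripe K L N0 k) (stripe K L N0 k') \<omega>"
    and low: "\<forall>\<eta>\<in>set \<omega>. hamiltonian K L \<eta> \<le> - ?b"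
    using N k by (auto simp: card_stripe_set stripe_eq)
  have lower: "ground_energy L N0 + 4 \<le> path_height K L \<xi>"
    if "is_path K L (L * N0) (stripe K L N0 k) (stripe K L N0 k') \<xi>" for \<xi>
    by (rule path_height_lower[OF _ _ _ _ _ _ that]) (use assms N k in auto)
  have "\<omega> \<noteq> []" using path unfolding is_path_def by blast
  then have "path_height K L \<omega> \<le> - ?b"
    unfolding path_height_def using low by simp
  \<comment> \<open>The constructed path attains the lower bound, so the \<open>LEAST\<close> in
    \<open>comm_height\<close> is this value.\<close>
  then have "path_height K L \<omega> = ground_energy L N0 + 4"
    using lower[OF path] by simp
  then show ?thesis
    unfolding comm_height_def using path lower by (intro Least_equality) auto
qed

end
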